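(* Let $\Lambda\subset\mathbb{C}$ be an algebraic Delone set. Then the set $\mathcal{C}(K_\Lambda^+)$ is finite, and there is a number $b_\Lambda\in\mathbb{N}$ that only depends on $\Lambda$ such that the following holds. Let $U\subset\mathbb{S}^1$ be a finite set of four or more pairwise nonparallel $\Lambda$-directions and suppose that there exists a $U$-polygon. Then the cross ratio of the slopes of any four directions of $U$, arranged in order of increasing angle with the positive real axis, is an element of $\mathcal{C}(K_\Lambda^+)$, and $\operatorname{card}(U)\leq b_\Lambda$.
   Context: The Euclidean plane is identified with $\mathbb{C}$; natural numbers are positive. For $r>0$, $B_r(z)$ is the open ball of radius $r$ about $z\in\mathbb{C}$. A set $\Lambda\subset\mathbb{C}$ is uniformly discrete if there is $r>0$ such that every $B_r(z)$, $z\in\mathbb{C}$, contains at most one point of $\Lambda$; it is relatively dense if there is $R>0$ such that every $B_R(z)$, $z\in\mathbb{C}$, contains at least one point of $\Lambda$; it is a Delone set if it is both. Let $\Lambda-\Lambda=\{v-w : v,w\in\Lambda\}$, let $K_\Lambda:=\mathbb{Q}\big((\Lambda-\Lambda)\cup\overline{(\Lambda-\Lambda)}\big)\subset\mathbb{C}$, the field generated over $\mathbb{Q}$ by all differences of points of $\Lambda$ and their complex conjugates, and let $K_\Lambda^+:=K_\Lambda\cap\mathbb{R}$. A homothety of the complex plane is a map $z\mapsto\lambda z+t$ with $\lambda\in\mathbb{R}$, $\lambda>0$, $t\in\mathbb{C}$. A Delone set $\Lambda\subset\mathbb{C}$ is an algebraic Delone set if: (Alg) $[K_\Lambda:\mathbb{Q}]<\infty$;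 and (Hom) for any finite subset $F$ of $K_\Lambda$ there is a homothety $h$ of the complex plane with $h(F)\subset\Lambda$. Elements of the unit circle $\mathbb{S}^1\subset\mathbb{C}$ are called directions. A direction is a $\Lambda$-direction if it is parallel to a nonzero element of $\Lambda-\Lambda$. The slope of $z\in\mathbb{C}^*$ is $\operatorname{sl}(z)=-i(z-\bar z)/(z+\bar z)\in\mathbb{R}\cup\{\infty\}$. The angle of a direction with the positive real axis is that of the line through $0$ in this direction, taken in $[0,\pi)$. The cross ratio of an ordered tuple of four pairwise distinct elements of $\mathbb{R}\cup\{\infty\}$ is $\langle t_1,t_2,t_3,t_4\rangle=\frac{(t_3-t_1)(t_4-t_2)}{(t_3-t_2)(t_4-t_1)}$, with the usual conventions if one of the $t_i$ is $\infty$. A convex polygon is the convex hull of a finite set of points of $\mathbb{C}$. For a finite set $U\subset\mathbb{S}^1$ of directions, a $U$-polygon is a nondegenerate convex polygon $P$ such that whenever $v$ is a vertex of $P$ and $u\in U$, the line in direction $u$ through $v$ also meets another vertex $v'\ne v$ of $P$. For $m\geq 4$ put $\zeta_m=e^{2\pi i/m}$, $$D_m=\{(k_1,k_2,k_3,k_4)\in\mathbb{N}^4 : k_3<k_1\le k_2<k_4\le m-1,\ k_1+k_2=k_3+k_4\},$$ $$f_m(k_1,k_2,k_3,k_4)=\frac{(1-\zeta_m^{k_1})(1-\zeta_m^{k_2})}{(1-\zeta_m^{k_3})(1-\zeta_m^{k_4})},$$ $\mathcal{C}_m=f_m(D_m)$, $\mathcal{C}=\bigcup_{m\ge4}\mathcal{C}_m$,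 and, for $K\subset\mathbb{C}$, $\mathcal{C}(K)=\mathcal{C}\cap K$. *)

theory Defs
  imports "HOL-Analysis.Analysis" "HOL-Algebra.Generated_Fields"
    "HOL-Algebra.Embedded_Algebras" "HOL-Algebra.Algebraic_Closure_Type"
begin

section \<open>Algebraic Delone sets\<close>

definition uniformly_discrete :: "complex set \<Rightarrow> bool" where
  "uniformly_discrete \<Lambda> \<longleftrightarrow>
     (\<exists>r>0. \<forall>z. \<forall>x \<in> \<Lambda> \<inter> ball z r. \<forall>y \<in> \<Lambda> \<inter> ball z r. x = y)"

definition relatively_dense :: "complex set \<Rightarrow> bool" where
  "relatively_dense \<Lambda> \<longleftrightarrow> (\<exists>R>0. \<forall>z. \<Lambda> \<inter> ball z R \<noteq> {})"

definition Delone_set :: "complex set \<Rightarrow> bool" where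
  "Delone_set \<Lambda> \<longleftrightarrow> uniformly_discrete \<Lambda> \<and> relatively_dense \<Lambda>"

definition differences :: "complex set \<Rightarrow> complex set" where
  "differences \<Lambda> = {v - w | v w. v \<in> \<Lambda> \<and> w \<in> \<Lambda>}"

abbreviation complex_field :: "complex ring" where
  "complex_field \<equiv> ring_of_type_algebra"

text \<open>
  In characteristic 0 the subfield generated by a set is the field generated by it over the
  rationals.
\<close>

definition K_field :: "complex set \<Rightarrow> complex set" where
  "K_field \<Lambda> = generate_field complex_field (differences \<Lambda> \<union> cnj ` differences \<Lambda>)"

definition K_plus :: "complex set \<Rightarrow> complex set" where
  "K_plus \<Lambda> = K_field \<Lambda> \<inter> \<real>"

definition homothety :: "(complex \<Rightarrow> complex) \<Rightarrow> bool" where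
  "homothety h \<longleftrightarrow> (\<exists>(l::real) (t::complex). l > 0 \<and> h = (\<lambda>z. of_real l * z + t))"

definition algebraic_Delone_set :: "complex set \<Rightarrow> bool" where
  "algebraic_Delone_set \<Lambda> \<longleftrightarrow>
     Delone_set \<Lambda> \<and>
     ring.finite_dimension complex_field \<rat> (K_field \<Lambda>) \<and>
     (\<forall>F. finite F \<and> F \<subseteq> K_field \<Lambda> \<longrightarrow> (\<exists>h. homothety h \<and> h ` F \<subseteq> \<Lambda>))"

section \<open>Directions, slopes, angles and cross ratios\<close>

definition parallel :: "complex \<Rightarrow> complex \<Rightarrow> bool" where
  "parallel z w \<longleftrightarrow> (\<exists>c::real. c \<noteq> 0 \<and> z = of_real c * w)"

definition Lambda_direction :: "complex set \<Rightarrow> complex \<Rightarrow> bool" where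
  "Lambda_direction \<Lambda> u \<longleftrightarrow>
     u \<in> sphere 0 1 \<and> (\<exists>d \<in> differences \<Lambda>. d \<noteq> 0 \<and> parallel u d)"

text \<open>The one-point extension of the reals by a single (unsigned) point at infinity.\<close>

datatype real_inf = Fin real | Infty

text \<open>
  For nonzero \<open>z\<close>. The quotient below is a real number, so taking the real part only changes its
  type; \<open>z + cnj z\<close> vanishes exactly on the imaginary axis.
\<close>

definition slope :: "complex \<Rightarrow> real_inf" where
  "slope z = (if z + cnj z = 0 then Infty else Fin (Re (- \<i> * (z - cnj z) / (z + cnj z))))"

definition line_angle :: "complex \<Rightarrow> real" where
  "line_angle u = (THE \<theta>. 0 \<le> \<theta> \<and> \<theta> < pi \<and> (\<exists>r::real. u = of_real r * cis \<theta>))"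

text \<open>
  If one argument is infinite, the two factors that contain it cancel. Two infinite arguments
  are outside the domain (the arguments have to be pairwise distinct).
\<close>

fun cross_ratio :: "real_inf \<Rightarrow> real_inf \<Rightarrow> real_inf \<Rightarrow> real_inf \<Rightarrow> real" where
  "cross_ratio (Fin a) (Fin b) (Fin c) (Fin d) = ((c - a) * (d - b)) / ((c - b) * (d - a))"
| "cross_ratio Infty (Fin b) (Fin c) (Fin d) = (d - b) / (c - b)"
| "cross_ratio (Fin a) Infty (Fin c) (Fin d) = (c - a) / (d - a)"
| "cross_ratio (Fin a) (Fin b) Infty (Fin d) = (d - b) / (d - a)"
| "cross_ratio (Fin a) (Fin b) (Fin c) Infty = (c - a) / (c - b)"
| "cross_ratio _ _ _ _ = undefined"

section \<open>U-polygons\<close>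

definition line_through :: "complex \<Rightarrow> complex \<Rightarrow> complex set" where
  "line_through v u = {v + of_real r * u | r::real. True}"

definition U_polygon :: "complex set \<Rightarrow> complex set \<Rightarrow> bool" where
  "U_polygon U P \<longleftrightarrow>
     polytope P \<and> interior P \<noteq> {} \<and>
     (\<forall>v u. v extreme_point_of P \<and> u \<in> U \<longrightarrow>
        (\<exists>v'. v' extreme_point_of P \<and> v' \<noteq> v \<and> v' \<in> line_through v u))"

section \<open>The sets of cyclotomic quotients\<close>

definition zeta :: "nat \<Rightarrow> complex" where
  "zeta m = exp (2 * of_real pi * \<i> / of_nat m)"

definition D_set :: "nat \<Rightarrow> (nat \<times> nat \<times> nat \<times> nat) set" where
  "D_set m = {(k1, k2, k3, k4). 1 \<le> k3 \<and> k3 < k1 \<and> k1 \<le> k2 \<and> k2 < k4 \<and> k4 \<le> m - 1 \<and>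
                k1 + k2 = k3 + k4}"

definition f_quot :: "nat \<Rightarrow> nat \<times> nat \<times> nat \<times> nat \<Rightarrow> complex" where
  "f_quot m = (\<lambda>(k1, k2, k3, k4).
     ((1 - zeta m ^ k1) * (1 - zeta m ^ k2)) / ((1 - zeta m ^ k3) * (1 - zeta m ^ k4)))"

definition C_level :: "nat \<Rightarrow> complex set" where
  "C_level m = f_quot m ` D_set m"

definition C_in :: "complex set \<Rightarrow> complex set" where
  "C_in K = (\<Union>m\<in>{4..}. C_level m) \<inter> K"

end

(*
  Combinatorics and Fourier analysis.  Number the n vertices p_0, p_1, ... of a U-polygon in cyclic
  order.  Projecting along u in U pairs the vertices as p_l <-> p_{c-l} for some c = c(u).  This
  condition is linear in p and is respected by each pair of frequencies l, -l of the discrete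
  Fourier transform, so it passes from p to its first harmonic, an affine image of the regular
  n-gon.  The first harmonic does not vanish (Chebyshev's sum inequality for the heights over u),
  and it is nondegenerate because there are at least three directions.  So U is linearly equivalent
  to a set of directions at angles c(u) pi / n, and cross ratios of slopes are quotients of sines.

  Finiteness.  For x = N(zeta) / M(zeta) let R be the product of M(xi) X - N(xi) over the conjugates
  xi of zeta.  It is an integer polynomial all of whose roots are conjugates of x, hence a constant
  times a power of the primitive minimal polynomial g of x.  Since |M|, |N| <= 4 on the unit circle,
  |g(k)| <= (4k + 4)^(deg g) for every natural number k.  As deg g is at most the degree of the
  field, only finitely many g are possible.

  Three directions and the cross ratio determine a fourth one, so card U is at most three more than
  the number of admissible cross ratios.
*)
theory Submission
  imports Defs
begin

section \<open>Cyclic order of points in convex position\<close>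

text \<open>A cross ratio of slopes is a quotient of signed areas \<open>Im (cnj u * v)\<close> in
  which each direction occurs once above and once below. Lengths, signs and the determinant of a
  linear map cancel, so it is enough to know the areas up to factors \<open>T u * T v\<close> and
  one common nonzero constant \<Delta>. The pairing l <-> c - l is a reflection with centre c / 2,
  possibly a half-integer; hence the half-step roots of unity \<open>half\<close>.

  The obstacle to finiteness is that m is unbounded: a quotient x of small degree may come from a
  cyclotomic field of huge degree, and x need not be an algebraic integer, since M(zeta) need not be
  a unit. The polynomial R meets both difficulties. Keeping the values of M as leading coefficients
  clears the denominators. Writing R = c g^r with a nonzero integer c gives |g(k)|^r <= |R(k)|,
  while R is a product of r deg g linear factors. Taking r-th roots removes r, and with it the
  number of conjugates of zeta.\<close>

definition orient :: "complex \<Rightarrow> complex \<Rightarrow> complex \<Rightarrow> real" where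
  "orient a b c = Im (cnj (b - a) * (c - a))"

lemma orient_rotate: "orient a b c = orient b c a"
  by (simp add: orient_def algebra_simps)

lemma orient_swap: "orient a b c = - orient a c b"
  by (simp add: orient_def algebra_simps)

text \<open>Cramer's rule for three vectors in the plane; the coefficients are doubled signed
  triangle areas. If they are nonnegative with positive sum, a is a convex combination of b, c, d,
  which is how convex position controls the signs of \<open>orient\<close>.\<close>

lemma orient_Cramer:
  "of_real (orient a c d) * (b - a) + of_real (orient a d b) * (c - a)
     + of_real (orient a b c) * (d - a) = 0"
  by (simp add: orient_def complex_eq_iff algebra_simps)

definition convex_position :: "complex set \<Rightarrow> bool" where
  "convex_position V \<longleftrightarrow> (\<forall>v\<in>V. v \<notin> convex hull (V - {v}))"

text \<open>Division by the total weight puts a into the hull of b, c, d. These may coincide, which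
  covers points on a segment.\<close>

lemma convex_position_no_combination:
  assumes V: "convex_position V" and pts: "a \<in> V" "{b, c, d} \<subseteq> V - {a}"
    and coeffs: "p \<ge> 0" "q \<ge> 0" "r \<ge> 0" "p + q + r > 0"
    and comb: "of_real p * (b - a) + of_real q * (c - a) + of_real r * (d - a) = 0"
  shows False
proof -
  define s where "s = p + q + r"
  have "s > 0" using coeffs by (simp add: s_def)
  have "of_real s * a = of_real p * b + of_real q * c + of_real r * d"
    using comb by (simp add: s_def algebra_simps)
  then have "a = (of_real p * b + of_real q * c + of_real r * d) / of_real s"
    using \<open>s > 0\<close> by (simp add: field_simps)
  also have "\<dots> = (p / s) *\<^sub>R b + (q / s) *\<^sub>R c + (r / s) *\<^sub>R d"
    by (simp add: scaleR_conv_of_real add_divide_distrib)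
  also have "\<dots> \<in> convex hull {b, c, d}"
    unfolding convex_hull_3 using coeffs \<open>s > 0\<close>
    by (intro CollectI exI[of _ "p / s"] exI[of _ "q / s"] exI[of _ "r / s"])
       (simp add: s_def add_divide_distrib[symmetric])
  also have "\<dots> \<subseteq> convex hull (V - {a})" using pts by (intro hull_mono)
  finally show False using V pts by (auto simp: convex_position_def)
qed

text \<open>Collinearity gives \<open>c = a + r * (b - a)\<close>. The cases r < 0, 0 <= r <= 1 and
  r > 1 tell which of a, c, b lies between the other two.\<close>

lemma orient_nonzero:
  assumes V: "convex_position V" and abc: "a \<in> V" "b \<in> V" "c \<in> V" "a \<noteq> b" "b \<noteq> c" "a \<noteq> c"
  shows "orient a b c \<noteq> 0"
proof
  assume 0: "orient a b c = 0"
  define r where "r = Re (cnj (b - a) * (c - a)) / (cmod (b - a))\<^sup>2"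
  have "cnj (b - a) * (c - a) = of_real (r * (cmod (b - a))\<^sup>2)"
    using 0 abc by (auto simp: orient_def r_def complex_eq_iff)
  also have "\<dots> = of_real r * (cnj (b - a) * (b - a))"
    by (simp add: complex_norm_square mult.commute del: of_real_power)
  finally have "cnj (b - a) * (c - a) = cnj (b - a) * (of_real r * (b - a))"
    by (simp only: mult_ac)
  then have c: "c - a = of_real r * (b - a)" using abc by simp
  have c': "c = a + of_real r * (b - a)" using c by (simp add: algebra_simps)
  consider "r < 0" | "0 \<le> r" "r \<le> 1" | "r > 1" by linarith
  then show False
  proof cases
    case 1
    have "of_real (- r) * (b - a) + of_real 1 * (c - a) + of_real 0 * (b - a) = 0" using c by simp
    with 1 abc show False by (intro convex_position_no_combination[OF V abc(1), of b c b "- r" 1 0]) auto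
  next
    case 2
    have "of_real (1 - r) * (a - c) + of_real r * (b - c) + of_real 0 * (a - c) = 0"
      unfolding c' by (simp add: algebra_simps)
    with 2 abc show False by (intro convex_position_no_combination[OF V abc(3), of a b a "1 - r" r 0]) auto
  next
    case 3
    have "of_real (r - 1) * (a - b) + of_real 1 * (c - b) + of_real 0 * (a - b) = 0"
      unfolding c' by (simp add: algebra_simps)
    with 3 abc show False by (intro convex_position_no_combination[OF V abc(2), of a c a "r - 1" 1 0]) auto
  qed
qed

text \<open>If a, b, d did not turn left, no coefficient in \<open>orient_Cramer\<close> at a would
  be negative, and a would lie in the triangle b c d. So the angular order seen from a is
  transitive.\<close>

lemma orient_trans:
  assumes V: "convex_position V" and pts: "a \<in> V" "{b, c, d} \<subseteq> V - {a}"
    and pos: "orient a b c > 0" "orient a c d > 0"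
  shows "orient a b d > 0"
proof (rule ccontr)
  assume "\<not> orient a b d > 0"
  then have "orient a d b \<ge> 0" by (simp add: orient_swap[of a b d])
  with pos show False
    by (intro convex_position_no_combination[OF V pts _ _ _ _ orient_Cramer]) auto
qed

text \<open>The same argument with apex c. It carries positivity from triples through a base point a
  to triples avoiding it.\<close>

lemma orient_drop_first:
  assumes V: "convex_position V" and pts: "c \<in> V" "{a, b, d} \<subseteq> V - {c}"
    and pos: "orient a b c > 0" "orient a c d > 0"
  shows "orient b c d > 0"
proof (rule ccontr)
  assume "\<not> orient b c d > 0"
  then have "orient c b d \<ge> 0" using orient_rotate[of c b d] orient_swap[of b c d] by linarith
  moreover have "orient c d a > 0" "orient c a b > 0"
    using pos orient_rotate[of a c d] orient_rotate[of c a b] by linarith+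
  ultimately show False
    by (intro convex_position_no_combination[OF V pts _ _ _ _ orient_Cramer]) auto
qed

text \<open>Insertion sort for a relation that is total and transitive on S only, as is the angular
  order seen from a base vertex.\<close>

lemma ex_sorted_wrt:
  assumes "finite S" and total: "\<And>x y. x \<in> S \<Longrightarrow> y \<in> S \<Longrightarrow> x \<noteq> y \<Longrightarrow> R x y \<or> R y x"
    and trans: "\<And>x y z. x \<in> S \<Longrightarrow> y \<in> S \<Longrightarrow> z \<in> S \<Longrightarrow> R x y \<Longrightarrow> R y z \<Longrightarrow> R x z"
  shows "\<exists>xs. set xs = S \<and> distinct xs \<and> sorted_wrt R xs"
  using assms
proof (induction S rule: finite_induct)
  case (insert x S)
  have "\<exists>xs. set xs = S \<and> distinct xs \<and> sorted_wrt R xs"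
  proof (rule insert.IH)
    show "R y z \<or> R z y" if "y \<in> S" "z \<in> S" "y \<noteq> z" for y z
      by (rule insert.prems(1)) (use that in simp_all)
    show "R y w" if "y \<in> S" "z \<in> S" "w \<in> S" "R y z" "R z w" for y z w
      by (rule insert.prems(2)[of y z w]) (use that in simp_all)
  qed
  then obtain xs where xs: "set xs = S" "distinct xs" "sorted_wrt R xs"
    by blast
  let ?xs = "filter (\<lambda>y. R y x) xs @ x # filter (\<lambda>y. \<not> R y x) xs"
  have gt: "R x y" if "y \<in> S" "\<not> R y x" for y
  proof -
    have "x \<noteq> y" using that insert.hyps by blast
    then show ?thesis using insert.prems(1)[of x y] that by blast
  qed
  have lt: "R y z" if "y \<in> S" "z \<in> S" "R y x" "\<not> R z x" for y z
    by (rule insert.prems(2)[of y x z]) (use gt that in simp_all)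
  have "sorted_wrt R ?xs"
    unfolding sorted_wrt_append sorted_wrt.simps
    using xs(1) gt lt by (simp add: sorted_wrt_filter xs(3))
  moreover have "distinct ?xs" using xs insert.hyps by auto
  moreover have "set ?xs = insert x S" using xs by auto
  ultimately show ?case by blast
next
  case empty
  show ?case by (intro exI[of _ "[]"]) simp
qed

text \<open>The points are sorted by angle around one of them. With periodic integer indices,
  counterclockwise order reads \<open>i < j < k < i + n\<close>, so later arguments have no
  wrap-around cases.\<close>

theorem cyclic_enumeration:
  assumes V: "convex_position V" and fin: "finite V" "V \<noteq> {}"
  defines "n \<equiv> int (card V)"
  shows "\<exists>p :: int \<Rightarrow> complex. range p = V \<and> (\<forall>i. p (i + n) = p i) \<and>
    (\<forall>i j k. i < j \<longrightarrow> j < k \<longrightarrow> k < i + n \<longrightarrow> orient (p i) (p j) (p k) > 0)"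
proof -
  obtain a where a: "a \<in> V" using fin by blast
  have "\<exists>xs. set xs = V - {a} \<and> distinct xs \<and> sorted_wrt (\<lambda>x y. orient a x y > 0) xs"
  proof (rule ex_sorted_wrt)
    show "orient a x y > 0 \<or> orient a y x > 0" if "x \<in> V - {a}" "y \<in> V - {a}" "x \<noteq> y" for x y
      using orient_nonzero[OF V, of a x y] that a orient_swap[of a x y] by auto
    show "orient a x z > 0"
      if "x \<in> V - {a}" "y \<in> V - {a}" "z \<in> V - {a}" "orient a x y > 0" "orient a y z > 0" for x y z
      using orient_trans[OF V a, of x y z] that by auto
  qed (use fin in auto)
  then obtain xs where xs: "set xs = V - {a}" "distinct xs" "sorted_wrt (\<lambda>x y. orient a x y > 0) xs"
    by blast
  define L where "L = a # xs"
  have L: "set L = V" "distinct L" using xs a by (auto simp: L_def)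
  have len: "int (length L) = n" using distinct_card[OF L(2)] L(1) by (simp add: n_def)
  have npos: "n > 0" using fin by (simp add: n_def card_gt_0_iff)
  have first: "orient a (L ! j) (L ! k) > 0" if "0 < j" "j < k" "k < length L" for j k
    using sorted_wrt_nth_less[OF xs(3), of "j - 1" "k - 1"] that by (simp add: L_def)
  have ord: "orient (L ! i) (L ! j) (L ! k) > 0" if ijk: "i < j" "j < k" "k < length L" for i j k
  proof (cases i)
    case 0
    then have "0 < j" using ijk by simp
    from first[OF this ijk(2,3)] show ?thesis by (simp add: 0 L_def)
  next
    case (Suc i')
    have ne: "L ! x \<noteq> L ! y" if "x < length L" "y < length L" "x \<noteq> y" for x y
      using nth_eq_iff_index_eq[OF L(2)] that by blast
    have "L ! 0 = a" "L \<noteq> []" by (simp_all add: L_def)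
    have jl: "j < length L" using ijk by simp
    have inV: "L ! x \<in> V" if "x < length L" for x using nth_mem[OF that] L(1) by simp
    have "x \<in> V - {L ! j}" if "x \<in> {a, L ! i, L ! k}" for x
    proof -
      from that consider "x = L ! 0" | "x = L ! i" | "x = L ! k" using \<open>L ! 0 = a\<close> by blast
      then show ?thesis
        using ne[of 0 j] ne[of i j] ne[of k j] inV[of 0] inV[of i] inV[of k] ijk \<open>L \<noteq> []\<close> by cases simp_all
    qed
    then have pts: "{a, L ! i, L ! k} \<subseteq> V - {L ! j}" by blast
    have "orient a (L ! i) (L ! j) > 0" "orient a (L ! j) (L ! k) > 0"
      by (rule first; use ijk Suc in linarith)+
    then show ?thesis by (rule orient_drop_first[OF V inV[OF jl] pts])
  qed
  define p where "p i = L ! nat (i mod n)" for i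
  have per: "p (i + n) = p i" for i by (simp add: p_def)
  have small: "p i = L ! nat i" if "0 \<le> i" "i < n" for i using that by (simp add: p_def)
  have small2: "p i = L ! nat (i - n)" if "n \<le> i" "i < 2 * n" for i
    using small[of "i - n"] per[of "i - n"] that by simp
  have ordn: "orient (L ! nat i) (L ! nat j) (L ! nat k) > 0"
    if "0 \<le> i" "i < j" "j < k" "k < n" for i j k
    using that len by (intro ord) auto
  \<comment> \<open>The indices j and k may reach into the next period; moving them back by n
    permutes the triple cyclically, which leaves \<open>orient\<close> unchanged.\<close>
  have base: "orient (p i) (p j) (p k) > 0"
    if "0 \<le> i" "i < n" "i < j" "j < k" "k < i + n" for i j k
  proof -
    consider "k < n" | "j < n" "n \<le> k" | "n \<le> j" by linarith
    then show ?thesis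
    proof cases
      case 1
      then have "p i = L ! nat i" "p j = L ! nat j" "p k = L ! nat k"
        using that by (intro small; linarith)+
      moreover have "orient (L ! nat i) (L ! nat j) (L ! nat k) > 0" by (rule ordn; use that 1 in linarith)
      ultimately show ?thesis by metis
    next
      case 2
      have "p i = L ! nat i" "p j = L ! nat j" by (rule small; use that 2 in linarith)+
      moreover have "p k = L ! nat (k - n)" by (rule small2; use that 2 in linarith)
      moreover have "orient (L ! nat (k - n)) (L ! nat i) (L ! nat j) > 0"
        by (rule ordn; use that 2 in linarith)
      ultimately show ?thesis using orient_rotate[of "p k" "p i" "p j"] by metis
    next
      case 3
      have "p i = L ! nat i" by (rule small; use that 3 in linarith)
      moreover have "p j = L ! nat (j - n)" "p k = L ! nat (k - n)"
        by (rule small2; use that 3 in linarith)+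
      moreover have "orient (L ! nat (j - n)) (L ! nat (k - n)) (L ! nat i) > 0"
        by (rule ordn; use that 3 in linarith)
      ultimately show ?thesis using orient_rotate[of "p i" "p j" "p k"] by metis
    qed
  qed
  have shift: "p (i - n * q) = p i" for i q
    using mod_mult_self2[of i n "- q"] by (simp add: p_def)
  have "orient (p i) (p j) (p k) > 0" if "i < j" "j < k" "k < i + n" for i j k
  proof -
    define q where "q = i div n"
    have "i - n * q = i mod n" unfolding q_def by (rule minus_mult_div_eq_mod)
    then have rng: "0 \<le> i - n * q" "i - n * q < n" using npos pos_mod_sign[of n i] pos_mod_bound[of n i] by linarith+
    then have "orient (p (i - n * q)) (p (j - n * q)) (p (k - n * q)) > 0"
      by (rule base) (use that rng in linarith)+
    then show ?thesis by (simp only: shift)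
  qed
  moreover have "range p = V"
  proof
    show "range p \<subseteq> V"
    proof
      fix v assume "v \<in> range p"
      then obtain i where v: "v = L ! nat (i mod n)" by (auto simp: p_def)
      have "nat (i mod n) < length L" using npos len by (simp add: nat_less_iff)
      then show "v \<in> V" unfolding v using nth_mem L(1) by blast
    qed
    show "V \<subseteq> range p"
    proof
      fix v assume "v \<in> V"
      then obtain i where "i < length L" "L ! i = v" by (metis L(1) in_set_conv_nth)
      then have "p (int i) = v" using small[of "int i"] len by simp
      then show "v \<in> range p" by blast
    qed
  qed
  ultimately show ?thesis using per by blast
qed

section \<open>Polygons paired by parallel chords\<close>

locale cyclic_polygon =
  fixes n :: int and p :: "int \<Rightarrow> complex"
  assumes n3: "n \<ge> 3" and per: "p (i + n) = p i"
    and orient_pos: "i < j \<Longrightarrow> j < k \<Longrightarrow> k < i + n \<Longrightarrow> orient (p i) (p j) (p k) > 0"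
begin

lemma per_mult: "p (i + n * k) = p i"
proof -
  have nat: "p (i + n * int k) = p i" for i k
  proof (induction k arbitrary: i)
    case (Suc k)
    have "p (i + n * int (Suc k)) = p ((i + n * int k) + n)" by (simp add: algebra_simps)
    then show ?case using Suc per by metis
  qed simp
  show ?thesis
  proof (cases "k \<ge> 0")
    case True
    then show ?thesis using nat[of i "nat k"] by simp
  next
    case False
    then show ?thesis using nat[of "i + n * k" "nat (- k)"] by (simp add: algebra_simps)
  qed
qed

end

text \<open>The window from i to i + n selects one index for the partner vertex and keeps it
  different from i modulo n.\<close>

locale chordal_polygon = cyclic_polygon +
  fixes u :: complex
  assumes u0: "u \<noteq> 0"
    and partner: "\<exists>j t. i < j \<and> j < i + n \<and> p j - p i = of_real t * u"
begin

text \<open>Height over the direction u, scaled by |u|: equal values mean the same line parallel to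
  u.\<close>

definition h :: "int \<Rightarrow> real" where "h i = Im (cnj u * p i)"

text \<open>The sign of t records whether the chord runs along or against u, hence on which side of
  it the vertices between i and j lie.\<close>

definition chord :: "int \<Rightarrow> int \<Rightarrow> real \<Rightarrow> bool" where
  "chord i j t \<longleftrightarrow> i < j \<and> j < i + n \<and> p j - p i = of_real t * u"

lemma h_per: "h (i + n) = h i"
  by (simp add: h_def per)

lemma chord_h: "chord i j t \<Longrightarrow> h j = h i"
proof -
  assume "chord i j t"
  then have "p j = p i + of_real t * u" by (simp add: chord_def algebra_simps)
  then show ?thesis by (simp add: h_def algebra_simps)
qed

text \<open>\<open>orient (p i) (p j) (p l)\<close> equals t times the height difference of l and i,
  and its sign depends only on whether l comes before or after j.\<close>

lemma chord_sides:
  assumes c: "chord i j t"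
  shows chord_inside: "i < l \<Longrightarrow> l < j \<Longrightarrow> t * (h l - h i) < 0"
    and chord_outside: "j < l \<Longrightarrow> l < i + n \<Longrightarrow> t * (h l - h i) > 0"
proof -
  have pj: "p j - p i = of_real t * u" using c by (simp add: chord_def)
  have o: "orient (p i) (p j) (p l) = t * (h l - h i)" for l
    unfolding orient_def pj by (simp add: h_def algebra_simps)
  { assume "i < l" "l < j"
    then have "orient (p i) (p l) (p j) > 0" using c by (intro orient_pos) (auto simp: chord_def)
    then show "t * (h l - h i) < 0" using o orient_swap[of "p i" "p l" "p j"] by simp }
  { assume "j < l" "l < i + n"
    then have "orient (p i) (p j) (p l) > 0" using c by (intro orient_pos) (auto simp: chord_def)
    then show "t * (h l - h i) > 0" using o by simp }
qed

text \<open>As n >= 3, some vertex is strictly off the chord: i + 1, or i + 2 if j = i + 1.\<close>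

lemma chord_nonzero:
  assumes c: "chord i j t"
  shows "t \<noteq> 0"
proof (cases "i + 1 < j")
  case True
  with chord_inside[OF c, of "i + 1"] show ?thesis by auto
next
  case False
  with c n3 have "j < i + 2" "i + 2 < i + n" by (auto simp: chord_def)
  with chord_outside[OF c, of "i + 2"] show ?thesis by auto
qed

lemma chord_exists: "\<exists>j t. chord i j t"
  using partner[of i] by (auto simp: chord_def)

lemma chord_rev: "chord i j t \<Longrightarrow> chord j (i + n) (- t)"
proof -
  assume c: "chord i j t"
  then have "p (i + n) - p j = - (p j - p i)" by (simp add: per)
  with c show ?thesis by (simp add: chord_def)
qed

text \<open>Chords parallel to u cannot cross, so the chord from i + 1 ends at some k < j. If k < j
  - 1, the vertex j - 1 lies strictly between the lines of the two chords, and its partner is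
  confined to the indices between k and j - 1. That third chord has the vertices i and i + 1 on the
  same side, although its height is strictly between theirs.\<close>

lemma next_chord:
  assumes c: "chord i j t" and ne: "j \<noteq> i + 1"
  shows "\<exists>t'. chord (i + 1) (j - 1) t' \<and> t * t' > 0"
proof -
  have ij: "i < j" "j < i + n" using c by (auto simp: chord_def)
  obtain k t' where c': "chord (i + 1) k t'" using chord_exists by blast
  have ik: "i + 1 < k" "k < i + 1 + n" using c' by (auto simp: chord_def)
  have hj: "h j = h i" and hk: "h k = h (i + 1)" using c c' by (auto dest: chord_h)
  have a: "t * (h (i + 1) - h i) < 0" using ij ne by (intro chord_inside[OF c]) auto
  have "k < j"
  proof (rule ccontr)
    assume "\<not> k < j"
    then consider "k = j" | "k = i + n" | "j < k" "k < i + n" using ik by linarith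
    then show False
    proof cases
      case 1
      with a hk hj show False by simp
    next
      case 2
      with a hk h_per[of i] show False by simp
    next
      case 3
      with a hk chord_outside[OF c, of k] show False by simp
    qed
  qed
  \<comment> \<open>Vertex i, read as i + n, is outside the new chord, while i + 1 is inside the old
    one; so t and t' have the same sign.\<close>
  have b: "t' * (h i - h (i + 1)) > 0"
    using chord_outside[OF c', of "i + n"] h_per[of i] \<open>k < j\<close> ij by simp
  have tt: "t * t' > 0" using a b by (metis minus_diff_eq mult_minus_right neg_less_0_iff_less zero_less_mult_iff mult_less_0_iff less_asym)
  have "k = j - 1"
  proof (rule ccontr)
    assume "k \<noteq> j - 1"
    define l where "l = j - 1"
    have l: "k < l" "l < j" using \<open>k \<noteq> j - 1\<close> \<open>k < j\<close> by (auto simp: l_def)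
    have l1: "t * (h l - h i) < 0" using l ik by (intro chord_inside[OF c]) auto
    have l2: "t' * (h l - h (i + 1)) > 0" using l ij by (intro chord_outside[OF c']) auto
    obtain r s where r: "chord l r s" using chord_exists by blast
    then have lr: "l < r" "r < l + n" by (auto simp: chord_def)
    have hr: "h r = h l" by (rule chord_h[OF r])
    have "i + n < r"
    proof (rule ccontr)
      assume "\<not> i + n < r"
      then consider "r = j" | "r = i + n" | "j < r" "r < i + n" using lr by (force simp: l_def)
      then show False
      proof cases
        case 1
        with l1 hr hj show False by simp
      next
        case 2
        with l1 hr h_per[of i] show False by simp
      next
        case 3
        with l1 hr chord_outside[OF c, of r] show False by simp
      qed
    qed
    \<comment> \<open>The index r lies beyond i + n. One period earlier it falls between i and l,
      and the chord is read backwards, from r' to l.\<close>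
    define r' where "r' = r - n"
    have "chord r' l (- s)"
    proof -
      have "p r' = p r" using per[of r'] by (simp add: r'_def)
      moreover have "p r = p l + of_real s * u" using r by (simp add: chord_def algebra_simps)
      ultimately show ?thesis using r lr by (simp add: chord_def r'_def)
    qed
    note c2 = this
    have hr': "h r' = h l" using chord_h[OF c2] by simp
    have "k < r'"
    proof (rule ccontr)
      assume "\<not> k < r'"
      moreover have "i < r'" using \<open>i + n < r\<close> by (simp add: r'_def)
      ultimately consider "r' = i + 1" | "r' = k" | "i + 1 < r'" "r' < k" by linarith
      then show False
      proof cases
        case 1
        with l2 hr' show False by simp
      next
        case 2
        with l2 hr' hk show False by simp
      next
        case 3
        with l2 hr' chord_inside[OF c', of r'] show False by simp
      qed
    qed
    have r'l: "r' < l" using lr by (simp add: r'_def)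
    \<comment> \<open>Both j and i + 1 + n come after l and before r' + n, hence lie on one side of
      the chord from r' to l.\<close>
    have "- s * (h j - h r') > 0" "- s * (h (i + 1 + n) - h r') > 0"
      using l \<open>k < r'\<close> r'l ik ij by (intro chord_outside[OF c2]; linarith)+
    then have s1: "- s * (h i - h l) > 0" and s2: "- s * (h (i + 1) - h l) > 0"
      using hj hr' h_per[of "i + 1"] by simp_all
    have "(- s * (h i - h l)) * (- s * (h (i + 1) - h l)) > 0" using s1 s2 by (rule mult_pos_pos)
    then have "(h i - h l) * (h (i + 1) - h l) * (s * s) > 0" by (simp add: mult_ac)
    then have p1: "(h i - h l) * (h (i + 1) - h l) > 0"
      using s1 by (simp add: zero_less_mult_iff not_square_less_zero)
    have "(t * (h l - h i)) * (t' * (h l - h (i + 1))) < 0" using l1 l2 by (rule mult_neg_pos)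
    then have "(t * t') * ((h i - h l) * (h (i + 1) - h l)) < 0" by (simp add: algebra_simps)
    with mult_pos_pos[OF tt p1] show False by linarith
  qed
  with c' tt show ?thesis by blast
qed

text \<open>
  \<open>q\<close> counts the edges parallel to \<open>u\<close> passed so far: beyond such an edge the partner of the next
  vertex jumps by \<open>n\<close> and the chord is reversed.
\<close>

lemma chord_chain:
  assumes c0: "chord 0 c t0"
  shows "\<exists>j t q. chord (int i) j t \<and> int i + j = c + int q * n \<and> t * t0 * (-1) ^ q > 0"
proof (induction i)
  case 0
  have "t0 * t0 * (-1) ^ 0 > 0" using chord_nonzero[OF c0] by (auto simp: zero_less_mult_iff linorder_neq_iff)
  with c0 show ?case by (intro exI[of _ c] exI[of _ t0] exI[of _ 0]) auto
next
  case (Suc i)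
  then obtain j t q where j: "chord (int i) j t" and q: "int i + j = c + int q * n"
    and t: "t * t0 * (-1) ^ q > 0" by blast
  have Suc_i: "int (Suc i) = int i + 1" by simp
  show ?case
  proof (cases "j = int i + 1")
    case True
    have "chord (int (Suc i)) (int i + n) (- t)"
      unfolding Suc_i using chord_rev[OF j] True by simp
    moreover have "int (Suc i) + (int i + n) = c + int (Suc q) * n"
      using q True by (simp add: algebra_simps)
    moreover have "- t * t0 * (-1) ^ Suc q > 0" using t by simp
    ultimately show ?thesis by blast
  next
    case False
    then obtain t' where t': "chord (int i + 1) (j - 1) t'" "t * t' > 0" using next_chord[OF j] by blast
    have "(t * t0 * (-1) ^ q) * (t * t') > 0" using t t'(2) by (rule mult_pos_pos)
    then have "(t' * t0 * (-1) ^ q) * (t * t) > 0" by (simp add: mult_ac)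
    then have "t' * t0 * (-1) ^ q > 0" by (simp add: zero_less_mult_iff not_square_less_zero)
    moreover have "int (Suc i) + (j - 1) = c + int q * n" using q by simp
    ultimately show ?thesis using t'(1) unfolding Suc_i by blast
  qed
qed

end

section \<open>Sums over one period and roots of unity\<close>

lemma sum_periodic_reflect:
  fixes g :: "int \<Rightarrow> 'a :: comm_monoid_add"
  assumes "n > 0" and per: "\<And>i k. g (i + n * k) = g i"
  shows "(\<Sum>l\<in>{0..<n}. g (c - l)) = (\<Sum>l\<in>{0..<n}. g l)"
proof -
  have "(\<Sum>l\<in>{0..<n}. g ((c - l) mod n)) = (\<Sum>l\<in>{0..<n}. g l)"
  proof (rule sum.reindex_bij_betw)
    have inv: "(c - (c - l) mod n) mod n = l" if "l \<in> {0..<n}" for l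
      using that by (simp add: mod_diff_right_eq)
    show "bij_betw (\<lambda>l. (c - l) mod n) {0..<n} {0..<n}"
      by (rule bij_betw_byWitness[where f' = "\<lambda>l. (c - l) mod n"]) (use inv \<open>n > 0\<close> in auto)
  qed
  moreover have "g ((c - l) mod n) = g (c - l)" for l
    using per[of "(c - l) mod n" "(c - l) div n"] by (simp add: mult.commute)
  ultimately show ?thesis by simp
qed

lemma sum_periodic_shift:
  fixes g :: "int \<Rightarrow> 'a :: comm_monoid_add"
  assumes n: "n > 0" and per: "\<And>i k. g (i + n * k) = g i"
  shows "(\<Sum>l\<in>{0..<n}. g (l + c)) = (\<Sum>l\<in>{0..<n}. g l)"
proof -
  have per': "g (- (i + n * k)) = g (- i)" for i k
    using per[of "- i" "- k"] by (simp add: algebra_simps)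
  have "(\<Sum>l\<in>{0..<n}. g (l + c)) = (\<Sum>l\<in>{0..<n}. g (- (- c - l)))" by (simp add: algebra_simps)
  also have "\<dots> = (\<Sum>l\<in>{0..<n}. g (- l))"
    by (rule sum_periodic_reflect[of n "\<lambda>l. g (- l)"]) (use n per' in auto)
  also have "\<dots> = (\<Sum>l\<in>{0..<n}. g l)"
    using sum_periodic_reflect[of n g 0] n per by simp
  finally show ?thesis .
qed

lemma cis_periodic: "cis (x + 2 * pi * of_int k) = cis x"
  by (simp add: complex_eq_iff cos_add sin_add) 

definition harm :: "int \<Rightarrow> int \<Rightarrow> complex" where
  "harm n l = cis (2 * pi * of_int l / of_int n)"

lemma harm_per: "n > 0 \<Longrightarrow> harm n (l + n * k) = harm n l"
proof -
  assume "n > 0"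
  then have "2 * pi * of_int (l + n * k) / of_int n = 2 * pi * of_int l / of_int n + 2 * pi * of_int k"
    by (simp add: field_simps)
  then show ?thesis unfolding harm_def by (simp only: cis_periodic)
qed

lemma harm_add: "harm n (k + l) = harm n k * harm n l"
  unfolding harm_def cis_mult by (simp add: add_divide_distrib algebra_simps)

text \<open>A shift of the index multiplies the sum by \<open>harm n 1\<close>, which is not
  1.\<close>

lemma sum_harm:
  assumes "n \<ge> 2"
  shows "(\<Sum>l\<in>{0..<n}. harm n l) = 0"
proof -
  have "(\<Sum>l\<in>{0..<n}. harm n l) = (\<Sum>l\<in>{0..<n}. harm n (l + 1))"
    using assms by (intro sum_periodic_shift[symmetric] harm_per) auto
  also have "\<dots> = (\<Sum>l\<in>{0..<n}. harm n l) * harm n 1"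
    by (simp add: harm_add sum_distrib_right)
  finally have "(\<Sum>l\<in>{0..<n}. harm n l) * (1 - harm n 1) = 0" by (simp add: algebra_simps)
  moreover have "harm n 1 \<noteq> 1"
  proof
    assume "harm n 1 = 1"
    then have "cos (2 * pi / of_int n) = 1" unfolding harm_def by (simp add: complex_eq_iff)
    moreover have "cos (2 * pi / of_int n) < cos 0"
      using assms by (intro cos_monotone_0_pi) (auto simp: field_simps)
    ultimately show False by simp
  qed
  ultimately show ?thesis by simp
qed

lemma cos_less_outside:
  assumes "0 \<le> a" "a < x" "x < 2 * pi - a" "a \<le> pi"
  shows "cos x < cos a"
proof (cases "x \<le> pi")
  case True
  then show ?thesis using assms by (intro cos_monotone_0_pi) auto
next
  case False
  then have "cos (2 * pi - x) < cos a" using assms by (intro cos_monotone_0_pi) auto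
  then show ?thesis by (simp add: cos_diff)
qed

lemma cos_greater_inside:
  assumes "\<bar>x\<bar> < a" "a \<le> pi"
  shows "cos a < cos x"
  using cos_monotone_0_pi[of "\<bar>x\<bar>" a] assms by simp

section \<open>Fourier coefficients at the frequencies 1 and -1\<close>

context cyclic_polygon
begin

text \<open>\<open>F1\<close> and \<open>F2\<close> are unnormalised Fourier coefficients of p. Up
  to a factor n, the first harmonic of p is the image of the regular n-gon under the real-linear map
  z -> F1 z + F2 cnj z, whose determinant is |F1|^2 - |F2|^2.\<close>

definition F1 :: complex where "F1 = (\<Sum>l\<in>{0..<n}. p l * harm n (- l))"
definition F2 :: complex where "F2 = (\<Sum>l\<in>{0..<n}. p l * harm n l)"

abbreviation half :: "int \<Rightarrow> complex" where "half k \<equiv> cis (pi * of_int k / of_int n)"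

lemma half_harm: "half c * harm n (- l) = half (c - 2 * l)" "half (- c) * harm n l = half (- (c - 2 * l))"
  unfolding harm_def cis_mult
  by (rule arg_cong[where f = cis]; use n3 in \<open>simp add: field_simps\<close>)+

lemma half_F1_F2:
  "half c * F1 = (\<Sum>l\<in>{0..<n}. p l * half (c - 2 * l))"
  "half (- c) * F2 = (\<Sum>l\<in>{0..<n}. p l * half (- (c - 2 * l)))"
  unfolding F1_def F2_def sum_distrib_left half_harm[symmetric] by (simp_all only: mult_ac)

lemma half_diff: "half k - half (- k) = 2 * \<i> * of_real (sin (pi * of_int k / of_int n))"
  by (simp add: complex_eq_iff)

lemma half_add: "half k + half (- k) = 2 * of_real (cos (pi * of_int k / of_int n))"
  by (simp add: complex_eq_iff)

lemma sin_per: "sin (pi * of_int (c - 2 * (l + n * k)) / of_int n) = sin (pi * of_int (c - 2 * l) / of_int n)"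
proof -
  have "pi * of_int (c - 2 * (l + n * k)) / of_int n
      = pi * of_int (c - 2 * l) / of_int n + 2 * pi * of_int (- k)"
    using n3 by (simp add: field_simps)
  then have "cis (pi * of_int (c - 2 * (l + n * k)) / of_int n) = cis (pi * of_int (c - 2 * l) / of_int n)"
    by (simp only: cis_periodic)
  then show ?thesis by (simp add: complex_eq_iff)
qed

text \<open>The combination is 2i times S, the sum of p against a sine that is odd under l -> c - l.
  Pairing l with c - l turns 2 S into a real combination of chords, each a real multiple of
  u.\<close>

lemma direction_of_harmonic:
  assumes sym: "\<And>l. \<exists>t. p (c - l) - p l = of_real t * u"
  shows "\<exists>T. half c * F1 - half (- c) * F2 = \<i> * of_real T * u"
proof -
  define s where "s l = sin (pi * of_int (c - 2 * l) / of_int n)" for l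
  define S where "S = (\<Sum>l\<in>{0..<n}. p l * of_real (s l))"
  have s_per: "s (l + n * k) = s l" for l k unfolding s_def by (rule sin_per)
  have s_refl: "s (c - l) = - s l" for l
  proof -
    have "pi * of_int (c - 2 * (c - l)) / of_int n = - (pi * of_int (c - 2 * l) / of_int n)"
      using n3 by (simp add: field_simps)
    then show ?thesis unfolding s_def by (simp only: sin_minus)
  qed
  obtain t where t: "\<And>l. p (c - l) - p l = of_real (t l) * u" using sym by metis
  have "S = (\<Sum>l\<in>{0..<n}. p (c - l) * of_real (s (c - l)))"
    unfolding S_def using n3 by (intro sum_periodic_reflect[symmetric]) (auto simp: s_per per_mult)
  then have "2 * S = S + (\<Sum>l\<in>{0..<n}. p (c - l) * of_real (s (c - l)))" by simp
  also have "\<dots> = (\<Sum>l\<in>{0..<n}. - (p (c - l) - p l) * of_real (s l))"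
    unfolding S_def sum.distrib[symmetric] s_refl by (simp add: algebra_simps)
  also have "\<dots> = of_real (\<Sum>l\<in>{0..<n}. - t l * s l) * u"
    unfolding t of_real_sum sum_distrib_right by (simp add: mult_ac)
  finally have S: "2 * S = of_real (\<Sum>l\<in>{0..<n}. - t l * s l) * u" .
  have "half c * F1 - half (- c) * F2 = (\<Sum>l\<in>{0..<n}. p l * (half (c - 2 * l) - half (- (c - 2 * l))))"
    unfolding half_F1_F2 sum_subtractf[symmetric] right_diff_distrib ..
  also have "\<dots> = \<i> * (2 * S)"
    unfolding half_diff S_def s_def sum_distrib_left by (simp only: mult_ac)
  finally show ?thesis unfolding S by (metis mult.assoc)
qed

end

context chordal_polygon
begin

text \<open>
  Chebyshev's sum argument: for any two vertices, the differences of their heights over the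
  direction \<open>u\<close> and of the corresponding cosines have the same relative sign, so the double sum of
  the products of these differences, a multiple of a first Fourier coefficient, is not zero.
\<close>

lemma first_harmonic_nonzero: "F1 \<noteq> 0 \<or> F2 \<noteq> 0"
proof (rule ccontr)
  assume "\<not> (F1 \<noteq> 0 \<or> F2 \<noteq> 0)"
  then have F: "F1 = 0" "F2 = 0" by auto
  obtain c t0 where c0: "chord 0 c t0" using chord_exists by blast
  \<comment> \<open>A cosine, even under l -> c - l. It contains only the frequencies 1 and -1, so
    it is orthogonal to h once F1 and F2 vanish, and it sums to 0 over a period.\<close>
  define C where "C l = cos (pi * of_int (c - 2 * l) / of_int n)" for l
  have C_per: "C (l + n) = C l" for l
  proof -
    have "pi * of_int (c - 2 * (l + n)) / of_int n = pi * of_int (c - 2 * l) / of_int n + 2 * pi * of_int (- 1)"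
      using n3 by (simp add: field_simps)
    then have "cis (pi * of_int (c - 2 * (l + n)) / of_int n) = cis (pi * of_int (c - 2 * l) / of_int n)"
      by (simp only: cis_periodic)
    then show ?thesis by (simp add: complex_eq_iff C_def)
  qed
  have "0 = half c * F1 + half (- c) * F2" using F by simp
  also have "\<dots> = (\<Sum>l\<in>{0..<n}. p l * (half (c - 2 * l) + half (- (c - 2 * l))))"
    unfolding half_F1_F2 sum.distrib[symmetric] distrib_left ..
  also have "\<dots> = 2 * (\<Sum>l\<in>{0..<n}. p l * of_real (C l))"
    unfolding half_add C_def sum_distrib_left by (simp only: mult_ac)
  finally have "(\<Sum>l\<in>{0..<n}. p l * of_real (C l)) = 0" by simp
  then have "Im (cnj u * (\<Sum>l\<in>{0..<n}. p l * of_real (C l))) = 0" by simp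
  then have hC: "(\<Sum>l\<in>{0..<n}. h l * C l) = 0"
    unfolding sum_distrib_left Im_sum h_def by (simp add: algebra_simps)
  have Re_half: "Re (half (- k)) = cos (pi * of_int k / of_int n)" for k by simp
  have "(\<Sum>l\<in>{0..<n}. half (- (c - 2 * l))) = half (- c) * (\<Sum>l\<in>{0..<n}. harm n l)"
    unfolding sum_distrib_left half_harm ..
  also have "\<dots> = 0" using sum_harm n3 by simp
  finally have "Re (\<Sum>l\<in>{0..<n}. half (- (c - 2 * l))) = 0" by simp
  then have C0: "(\<Sum>l\<in>{0..<n}. C l) = 0" unfolding Re_sum Re_half C_def .
  \<comment> \<open>Up to the sign (-1)^q, C is the cosine of the angular distance to the midpoint
    of i and j: larger than at i for l between i and j, smaller beyond j. With \<open>t * h\<close>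
    it is the other way round. The sign (-1)^q accounts for the reversals of t relative to
    t0.\<close>
  have neg: "t0 * (h l - h i) * (C l - C i) < 0"
    if i: "i \<ge> 0" and c: "chord i j t" "i < l" "l < i + n" "l \<noteq> j"
      and q: "i + j = c + int q * n" and t: "t * t0 * (-1) ^ q > 0" for i j l t q
  proof -
    have ij: "i < j" "j < i + n" using that by (auto simp: chord_def)
    have npos: "real_of_int n > 0" using n3 by simp
    have arg: "C k = (-1) ^ q * cos (pi * of_int (2 * k - i - j) / of_int n)" for k
    proof -
      have "pi * of_int (c - 2 * k) / of_int n = - (pi * of_int (2 * k - i - j) / of_int n + real q * pi)"
      proof -
        have cq: "c = i + j - int q * n" using q by simp
        show ?thesis unfolding cq using npos by (simp add: field_simps)
      qed
      then have "C k = cos (pi * of_int (2 * k - i - j) / of_int n + real q * pi)"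
        unfolding C_def by (simp only: cos_minus)
      then show ?thesis by (simp add: cos_add)
    qed
    define a where "a = pi * of_int (j - i) / of_int n"
    define x where "x = pi * of_int (2 * l - i - j) / of_int n"
    have "pi * of_int (j - i) < pi * of_int n" using ij by (intro mult_strict_left_mono) auto
    then have a: "0 < a" "a < pi" using ij npos by (simp_all add: a_def pos_divide_less_eq)
    have "2 * i - i - j = - (j - i)" by simp
    then have "pi * of_int (2 * i - i - j) / of_int n = - a" unfolding a_def by (simp only: of_int_minus mult_minus_right minus_divide_left)
    then have Ci: "C i = (-1) ^ q * cos a" unfolding arg by simp
    have Cl: "C l = (-1) ^ q * cos x" unfolding arg x_def ..
    have sgn: "(t * (h l - h i)) * (cos x - cos a) < 0"
    proof (cases "l < j")
      case True
      have "\<bar>x\<bar> < a"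
      proof -
        have "\<bar>x\<bar> = pi * of_int \<bar>2 * l - i - j\<bar> / of_int n"
          using npos by (simp add: x_def abs_mult)
        also have "\<dots> < a"
          unfolding a_def using True c npos
          by (intro divide_strict_right_mono mult_strict_left_mono) auto
        finally show ?thesis .
      qed
      then have "cos x - cos a > 0" using cos_greater_inside a by simp
      with chord_inside[OF c(1,2) True] show ?thesis by (rule mult_neg_pos)
    next
      case False
      with c have "j < l" by simp
      have "a < x" unfolding a_def x_def using \<open>j < l\<close> npos
        by (intro divide_strict_right_mono mult_strict_left_mono) auto
      moreover have "x < 2 * pi - a"
      proof -
        have "pi * of_int (2 * l - i - j) < pi * of_int (2 * n - (j - i))"
          using c by (intro mult_strict_left_mono) auto
        then have "x < pi * of_int (2 * n - (j - i)) / of_int n"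
          unfolding x_def using npos by (intro divide_strict_right_mono)
        also have "\<dots> = 2 * pi - a" using npos by (simp add: a_def field_simps)
        finally show ?thesis .
      qed
      ultimately have "cos x - cos a < 0" using cos_less_outside[of a x] a by simp
      with chord_outside[OF c(1) \<open>j < l\<close> c(3)] show ?thesis by (rule mult_pos_neg)
    qed
    have "(t * (h l - h i) * (cos x - cos a)) * (t * t0 * (-1) ^ q) < 0"
      using sgn t by (rule mult_neg_pos)
    then have "(t0 * (h l - h i) * (C l - C i)) * (t * t) < 0"
      unfolding Ci Cl by (simp add: algebra_simps)
    then show ?thesis by (simp add: mult_less_0_iff not_square_less_zero)
  qed
  have neg': "t0 * (h l - h i) * (C l - C i) \<le> 0" if "i \<in> {0..<n}" "l \<in> {0..<n}" for i l
  proof -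
    obtain j t q where "chord (int (nat i)) j t" "int (nat i) + j = c + int q * n" "t * t0 * (-1) ^ q > 0"
      using chord_chain[OF c0] by blast
    then have j: "chord i j t" "i + j = c + int q * n" "t * t0 * (-1) ^ q > 0" using that by auto
    \<comment> \<open>Moves l into the window from i to i + n required by \<open>neg\<close>; at i
      and at its partner j the height difference is 0.\<close>
    define l' where "l' = (if l < i then l + n else l)"
    have l': "h l' = h l" "C l' = C l" by (auto simp: l'_def h_per C_per)
    have "t0 * (h l' - h i) * (C l' - C i) \<le> 0"
    proof (cases "l' = i \<or> l' = j")
      case True
      then have "h l' = h i" using chord_h[OF j(1)] by auto
      then show ?thesis by simp
    next
      case False
      have "t0 * (h l' - h i) * (C l' - C i) < 0"
        by (rule neg[OF _ j(1) _ _ _ j(2,3)]) (use that False in \<open>auto simp: l'_def\<close>)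
      then show ?thesis by simp
    qed
    with l' show ?thesis by simp
  qed
  have "\<exists>l\<in>{0..<n}. t0 * (h l - h 0) * (C l - C 0) < 0"
  proof -
    \<comment> \<open>Strictness needs one vertex other than 0 and its partner c; n >= 3 leaves room
      for it.\<close>
    define l :: int where "l = (if c = 1 then 2 else 1)"
    have "t0 * t0 * (-1) ^ 0 > 0" using chord_nonzero[OF c0] by (auto simp: zero_less_mult_iff linorder_neq_iff)
    then have "t0 * (h l - h 0) * (C l - C 0) < 0"
      by (intro neg[OF _ c0, of l 0]) (use n3 in \<open>auto simp: l_def\<close>)
    then show ?thesis using n3 by (intro bexI[of _ l]) (auto simp: l_def)
  qed
  then obtain l where l: "l \<in> {0..<n}" "t0 * (h l - h 0) * (C l - C 0) < 0" by blast
  have "(\<Sum>i\<in>{0..<n}. \<Sum>l\<in>{0..<n}. t0 * (h l - h i) * (C l - C i)) < (\<Sum>i\<in>{0..<n}. 0)"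
  proof (rule sum_strict_mono_ex1)
    show "\<forall>i\<in>{0..<n}. (\<Sum>l\<in>{0..<n}. t0 * (h l - h i) * (C l - C i)) \<le> 0"
      using neg' by (auto intro: sum_nonpos)
    have "(\<Sum>l\<in>{0..<n}. t0 * (h l - h 0) * (C l - C 0)) < (\<Sum>l\<in>{0..<n}. 0)"
      using neg' l n3 by (intro sum_strict_mono_ex1) auto
    then show "\<exists>i\<in>{0..<n}. (\<Sum>l\<in>{0..<n}. t0 * (h l - h i) * (C l - C i)) < 0"
      using n3 by (intro bexI[of _ 0]) auto
  qed simp
  \<comment> \<open>The double sum is 2 t0 times n (sum of h C) - (sum of h) (sum of C), and both
    products vanish.\<close>
  moreover have "(\<Sum>i\<in>{0..<n}. \<Sum>l\<in>{0..<n}. t0 * (h l - h i) * (C l - C i)) = 0"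
  proof -
    have "(\<Sum>l\<in>{0..<n}. t0 * (h l - h i) * (C l - C i))
        = t0 * h i * C i * of_int n - t0 * C i * (\<Sum>l\<in>{0..<n}. h l)" for i
    proof -
      have "(\<Sum>l\<in>{0..<n}. t0 * (h l - h i) * (C l - C i))
        = t0 * ((\<Sum>l\<in>{0..<n}. h l * C l) - C i * (\<Sum>l\<in>{0..<n}. h l)
            - h i * (\<Sum>l\<in>{0..<n}. C l) + (\<Sum>l\<in>{0..<n}. h i * C i))"
        unfolding sum_distrib_left sum_subtractf[symmetric] sum.distrib[symmetric]
        by (simp add: algebra_simps)
      also have "\<dots> = t0 * h i * C i * of_int n - t0 * C i * (\<Sum>l\<in>{0..<n}. h l)"
        unfolding hC C0 using n3 by (simp add: algebra_simps)
      finally show ?thesis .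
    qed
    then have "(\<Sum>i\<in>{0..<n}. \<Sum>l\<in>{0..<n}. t0 * (h l - h i) * (C l - C i))
        = t0 * of_int n * (\<Sum>i\<in>{0..<n}. h i * C i) - t0 * (\<Sum>i\<in>{0..<n}. C i) * (\<Sum>l\<in>{0..<n}. h l)"
      by (simp add: sum_subtractf sum_distrib_left sum_distrib_right mult_ac)
    also have "\<dots> = 0" unfolding hC C0 by simp
    finally show ?thesis .
  qed
  ultimately show False by simp
qed

text \<open>The index c is the partner of vertex 0. Reduction modulo n extends the pairing of
  \<open>chord_chain\<close> from nonnegative l to all integers. That t is nonzero serves later to
  separate the values c of different directions.\<close>

lemma direction_index:
  "\<exists>c T. half c * F1 - half (- c) * F2 = \<i> * of_real T * u \<and>
     (\<forall>l. \<exists>t. t \<noteq> 0 \<and> p (c - l) - p l = of_real t * u)"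
proof -
  obtain c t0 where c0: "chord 0 c t0" using chord_exists by blast
  have sym: "\<exists>t. t \<noteq> 0 \<and> p (c - l) - p l = of_real t * u" for l
  proof -
    obtain j t q where j: "chord (int (nat (l mod n))) j t" "int (nat (l mod n)) + j = c + int q * n"
      using chord_chain[OF c0] by blast
    have "int (nat (l mod n)) = l mod n" using n3 by simp
    note j = j[unfolded this]
    have l: "l = l mod n + n * (l div n)" by simp
    have "c - (r + n * d) = j + n * (- int q - d)" if "r + j = c + int q * n" for r d
      using that by (simp add: algebra_simps)
    from this[OF j(2), of "l div n"] have "c - l = j + n * (- int q - l div n)"
      by (simp only: mod_mult_div_eq)
    then have "p (c - l) = p j" by (simp only: per_mult)
    moreover have "p l = p (l mod n)" by (subst l) (rule per_mult)
    ultimately have "p (c - l) - p l = of_real t * u" using j(1) by (simp add: chord_def)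
    with chord_nonzero[OF j(1)] show ?thesis by blast
  qed
  then show ?thesis using direction_of_harmonic[of c u] by blast
qed

end

section \<open>Directions of a U-polygon\<close>

text \<open>If v were in the hull of the other extreme points, these alone would span P, and all
  extreme points of P would be among them.\<close>

lemma convex_position_extreme_points:
  "convex_position {v. v extreme_point_of P}" if "compact P" "convex P"
  unfolding convex_position_def
proof safe
  fix v assume v: "v extreme_point_of P"
    and in_hull: "v \<in> convex hull ({v. v extreme_point_of P} - {v})"
  let ?V = "{v. v extreme_point_of P}"
  have "convex hull (?V - {v}) = convex hull (insert v (?V - {v}))"
    by (rule hull_redundant[OF in_hull, symmetric])
  also have "insert v (?V - {v}) = ?V" using v by auto
  also have "convex hull ?V = P" using Krein_Milman_Minkowski[OF that] by simp
  finally have "v extreme_point_of (convex hull (?V - {v}))" using v by simp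
  then show False using extreme_point_of_convex_hull by blast
qed

lemma parallel_iff_Im_eq_0:
  assumes "u \<noteq> 0" "v \<noteq> 0"
  shows "parallel u v \<longleftrightarrow> Im (cnj u * v) = 0"
proof
  assume "parallel u v"
  then obtain c where "u = of_real c * v" by (auto simp: parallel_def)
  then show "Im (cnj u * v) = 0" by (simp add: algebra_simps)
next
  assume 0: "Im (cnj u * v) = 0"
  define c where "c = Re (cnj u * v) / (cmod v)\<^sup>2"
  have "u * cnj v = cnj (cnj u * v)" by simp
  also have "\<dots> = of_real (c * (cmod v)\<^sup>2)"
    using 0 assms by (simp add: complex_eq_iff c_def)
  also have "\<dots> = of_real c * (v * cnj v)"
    by (simp add: complex_norm_square del: of_real_power)
  finally have "u * cnj v = of_real c * v * cnj v" by (simp only: mult.assoc)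
  then have "u = of_real c * v" using assms by simp
  then show "parallel u v" using assms by (auto simp: parallel_def)
qed

lemma harm_eq_1:
  assumes "n > 0" "harm n k = 1"
  shows "n dvd k"
proof -
  have "cos (2 * pi * of_int k / of_int n) = 1" using assms(2) by (simp add: harm_def complex_eq_iff)
  then obtain q :: int where "2 * pi * of_int k / of_int n = of_int q * 2 * pi"
    using cos_one_2pi_int by auto
  then have "real_of_int k = of_int (q * n)" using assms(1) by (simp add: field_simps)
  then have "k = q * n" by linarith
  then show ?thesis by simp
qed

lemma sin_eq_0_dvd:
  assumes "n > 0" "sin (pi * of_int k / of_int n) = 0"
  shows "n dvd k"
proof -
  obtain q :: int where "pi * of_int k / of_int n = of_int q * pi"
    using assms(2) sin_zero_iff_int2 by auto
  then have "real_of_int k = of_int (q * n)" using assms(1) by (simp add: field_simps)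
  then have "k = q * n" by linarith
  then show ?thesis by simp
qed

text \<open>The two vectors are the images of cis \<alpha> and cis \<beta> under z -> a z - b cnj z,
  a real-linear map of determinant |a|^2 - |b|^2.\<close>

lemma Im_cross_of_half_combinations:
  "Im (cnj (cis \<alpha> * a - cis (- \<alpha>) * b) * (cis \<beta> * a - cis (- \<beta>) * b))
     = ((cmod a)\<^sup>2 - (cmod b)\<^sup>2) * sin (\<beta> - \<alpha>)"
  unfolding cmod_power2 by (simp add: sin_diff algebra_simps power2_eq_square)

text \<open>Affine regularity in the form that cross ratios need: up to scalings T u and a
  determinant \<Delta>, signed areas are those of unit vectors at angles pi c(u) / n.\<close>

theorem U_polygon_affinely_regular:
  assumes P: "U_polygon U P" and U: "finite U" "card U \<ge> 3" "0 \<notin> U"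
    and nonparallel: "\<forall>u\<in>U. \<forall>v\<in>U. u \<noteq> v \<longrightarrow> \<not> parallel u v"
  shows "\<exists>n::int. \<exists>\<Delta>::real. \<exists>c T. n > 0 \<and> \<Delta> \<noteq> 0 \<and> (\<forall>u\<in>U. T u \<noteq> 0) \<and>
    (\<forall>u\<in>U. \<forall>v\<in>U. T u * T v * Im (cnj u * v) = \<Delta> * sin (pi * of_int (c v - c u) / of_int n))"
proof -
  have U0: "u \<noteq> 0" if "u \<in> U" for u using U(3) that by metis
  have np: "\<not> parallel u v" if "u \<in> U" "v \<in> U" "u \<noteq> v" for u v using nonparallel that by blast
  define V where "V = {v. v extreme_point_of P}"
  have poly: "polytope P" and ne: "interior P \<noteq> {}" using P by (auto simp: U_polygon_def)
  then obtain S where S: "finite S" "P = convex hull S" by (auto simp: polytope_def)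
  have "V \<subseteq> S" unfolding V_def S(2) using extreme_point_of_convex_hull by blast
  then have fV: "finite V" using S by (auto intro: finite_subset)
  have compact: "compact P" and convex: "convex P"
    using poly by (auto intro: polytope_imp_compact polytope_imp_convex)
  have hull: "P = convex hull V" unfolding V_def by (rule Krein_Milman_Minkowski[OF compact convex])
  have "V \<noteq> {}" using hull ne by auto
  have cpos: "convex_position V" unfolding V_def by (rule convex_position_extreme_points[OF compact convex])
  have mate: "\<exists>v'\<in>V. v' \<noteq> v \<and> (\<exists>r::real. v' = v + of_real r * u)" if "v \<in> V" "u \<in> U" for v u
    using P that by (fastforce simp: U_polygon_def V_def line_through_def)
  obtain U3 where "U3 \<subseteq> U" "card U3 = 3" using U(2) by (meson obtain_subset_with_card_n)
  then obtain u1 u2 u3 where u123: "u1 \<in> U" "u2 \<in> U" "u3 \<in> U" "u1 \<noteq> u2" "u2 \<noteq> u3" "u1 \<noteq> u3"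
    by (auto simp: card_3_iff)
  \<comment> \<open>A vertex and its mates in two nonparallel directions are three distinct
    vertices.\<close>
  have "card V \<ge> 3"
  proof -
    obtain v where v: "v \<in> V" using \<open>V \<noteq> {}\<close> by blast
    obtain v1 r1 where v1: "v1 \<in> V" "v1 \<noteq> v" "v1 = v + of_real r1 * u1"
      using mate[OF v u123(1)] by blast
    obtain v2 r2 where v2: "v2 \<in> V" "v2 \<noteq> v" "v2 = v + of_real r2 * u2"
      using mate[OF v u123(2)] by blast
    have "v1 \<noteq> v2"
    proof
      assume "v1 = v2"
      then have "of_real r1 * u1 = of_real r2 * u2" using v1 v2 by simp
      moreover have "r1 \<noteq> 0" "r2 \<noteq> 0" using v1 v2 by auto
      ultimately have "u1 = of_real (r2 / r1) * u2" "r2 / r1 \<noteq> 0" by (simp_all add: field_simps)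
      with np u123 show False unfolding parallel_def by blast
    qed
    then have "card {v, v1, v2} = 3" using v1 v2 by auto
    moreover have "card {v, v1, v2} \<le> card V" using v v1 v2 fV by (intro card_mono) auto
    ultimately show ?thesis by simp
  qed
  define n where "n = int (card V)"
  obtain p :: "int \<Rightarrow> complex" where p: "range p = V" "\<And>i. p (i + n) = p i"
    "\<And>i j k. i < j \<Longrightarrow> j < k \<Longrightarrow> k < i + n \<Longrightarrow> orient (p i) (p j) (p k) > 0"
    using cyclic_enumeration[OF cpos fV \<open>V \<noteq> {}\<close>] unfolding n_def by blast
  interpret cyclic_polygon n p
    by unfold_locales (use p \<open>card V \<ge> 3\<close> in \<open>auto simp: n_def\<close>)
  have npos: "n > 0" using n3 by simp
  have chordal: "chordal_polygon n p u" if u: "u \<in> U" for u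
  proof unfold_locales
    show "u \<noteq> 0" using U0 u by blast
    fix i
    obtain v' r where v': "v' \<in> V" "v' \<noteq> p i" "v' = p i + of_real r * u"
      using mate[OF _ u, of "p i"] p(1) by blast
    then obtain k where k: "v' = p k" using p(1) by blast
    define j where "j = i + (k - i) mod n"
    have "k = j + n * ((k - i) div n)" unfolding j_def using mod_mult_div_eq[of "k - i" n] by linarith
    then have pj: "p j = p k" using per_mult by metis
    have "(k - i) mod n \<noteq> 0" using pj k v' by (auto simp: j_def)
    then have "i < j" "j < i + n" using pos_mod_sign[OF npos, of "k - i"] pos_mod_bound[OF npos, of "k - i"]
      by (auto simp: j_def)
    moreover have "p j - p i = of_real r * u" using v' k pj by simp
    ultimately show "\<exists>j t. i < j \<and> j < i + n \<and> p j - p i = of_real t * u" by blast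
  qed
  have "F1 \<noteq> 0 \<or> F2 \<noteq> 0" by (rule chordal_polygon.first_harmonic_nonzero[OF chordal[OF u123(1)]])
  have "\<exists>c T. half c * F1 - half (- c) * F2 = \<i> * of_real T * u \<and>
     (\<forall>l. \<exists>t. t \<noteq> 0 \<and> p (c - l) - p l = of_real t * u)" if "u \<in> U" for u
    using chordal_polygon.direction_index[OF chordal[OF that]] .
  then obtain c T where cT: "\<And>u. u \<in> U \<Longrightarrow> half (c u) * F1 - half (- c u) * F2 = \<i> * of_real (T u) * u"
    and csym: "\<And>u l. u \<in> U \<Longrightarrow> \<exists>t. t \<noteq> 0 \<and> p (c u - l) - p l = of_real t * u"
    by metis
  define \<Delta> where "\<Delta> = (cmod F1)\<^sup>2 - (cmod F2)\<^sup>2"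
  have rel: "T u * T v * Im (cnj u * v) = \<Delta> * sin (pi * of_int (c v - c u) / of_int n)"
    if uv: "u \<in> U" "v \<in> U" for u v
  proof -
    have h: "half (- k) = cis (- (pi * of_int k / of_int n))" for k by simp
    have "T u * T v * Im (cnj u * v) = Im (cnj (\<i> * of_real (T u) * u) * (\<i> * of_real (T v) * v))"
      by (simp add: algebra_simps)
    also have "\<dots> = \<Delta> * sin (pi * of_int (c v) / of_int n - pi * of_int (c u) / of_int n)"
      unfolding cT[OF uv(1), symmetric] cT[OF uv(2), symmetric] h Im_cross_of_half_combinations \<Delta>_def ..
    also have "pi * of_int (c v) / of_int n - pi * of_int (c u) / of_int n = pi * of_int (c v - c u) / of_int n"
      by (simp add: diff_divide_distrib algebra_simps)
    finally show ?thesis .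
  qed
  \<comment> \<open>If c u and c v agreed modulo n, vertex 0 would have the same partner in both
    directions, and u, v would be parallel.\<close>
  have cdist: "\<not> n dvd c u - c v" if uv: "u \<in> U" "v \<in> U" "u \<noteq> v" for u v
  proof
    assume "n dvd c u - c v"
    then obtain k where "c u - c v = n * k" ..
    then have "c u = c v + n * k" by simp
    then have "p (c u) = p (c v)" by (simp only: per_mult)
    moreover obtain t where t: "t \<noteq> 0" "p (c u) - p 0 = of_real t * u" using csym[OF uv(1), of 0] by auto
    moreover obtain t' where t': "t' \<noteq> 0" "p (c v) - p 0 = of_real t' * v" using csym[OF uv(2), of 0] by auto
    ultimately have "of_real t * u = of_real t' * v" by simp
    then have "u = of_real (t' / t) * v" using t by (simp add: field_simps)
    moreover have "t' / t \<noteq> 0" using t t' by simp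
    ultimately show False using np[OF uv] unfolding parallel_def by blast
  qed
  have nz: "Im (cnj u * v) \<noteq> 0" if "u \<in> U" "v \<in> U" "u \<noteq> v" for u v
    using np[OF that] parallel_iff_Im_eq_0 U0 that by blast
  \<comment> \<open>If \<Delta> = 0, then T u * T v = 0 for any two directions, so two of u1, u2, u3
    have T = 0. For both of them F2 / F1 is \<open>harm n (c w)\<close>, so their values of c agree
    modulo n.\<close>
  have "\<Delta> \<noteq> 0"
  proof
    assume "\<Delta> = 0"
    have one: "T u = 0 \<or> T v = 0" if "u \<in> U" "v \<in> U" "u \<noteq> v" for u v
      using rel[OF that(1,2)] nz[OF that] \<open>\<Delta> = 0\<close> by simp
    have two: False if uv: "u \<in> U" "v \<in> U" "u \<noteq> v" "T u = 0" "T v = 0" for u v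
    proof -
      have F2: "F2 = harm n (c w) * F1" if "w \<in> U" "T w = 0" for w
      proof -
        have "half (c w) * (half (c w) * F1) = half (c w) * (half (- c w) * F2)"
          using cT[OF that(1)] that(2) by simp
        then have "half (c w) * half (c w) * F1 = half (c w) * half (- c w) * F2"
          by (simp only: mult.assoc)
        moreover have "half (c w) * half (- c w) = 1" "half (c w) * half (c w) = harm n (c w)"
          by (simp_all add: cis_mult harm_def mult.assoc)
        ultimately show ?thesis by simp
      qed
      have "F1 \<noteq> 0" using F2[of u] uv \<open>F1 \<noteq> 0 \<or> F2 \<noteq> 0\<close> by auto
      moreover have "harm n (c u) * F1 = harm n (c v) * F1"
        by (rule trans[OF F2[OF uv(1,4), symmetric] F2[OF uv(2,5)]])
      ultimately have "harm n (c u) = harm n (c v)" by simp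
      moreover have "harm n (c u) = harm n (c u - c v) * harm n (c v)" by (simp flip: harm_add)
      moreover have "harm n (c v) \<noteq> 0" by (simp add: harm_def)
      ultimately have "harm n (c u - c v) = 1" by simp
      from harm_eq_1[OF npos this] cdist[OF uv(1-3)] show False by blast
    qed
    show False using one[of u1 u2] one[of u2 u3] one[of u1 u3] two[of u1 u2] two[of u2 u3] two[of u1 u3] u123
      by blast
  qed
  moreover have "T u \<noteq> 0" if u: "u \<in> U" for u
  proof -
    obtain v where v: "v \<in> U" "v \<noteq> u" using u123 by metis
    have "sin (pi * of_int (c v - c u) / of_int n) \<noteq> 0"
      using sin_eq_0_dvd[OF npos] cdist[OF v(1) u v(2)] by blast
    with rel[OF u v(1)] \<open>\<Delta> \<noteq> 0\<close> show ?thesis by auto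
  qed
  ultimately show ?thesis using npos rel by blast
qed

section \<open>Cross ratios\<close>

lemma one_minus_zeta_power:
  assumes "m > 0"
  shows "1 - zeta m ^ k = - 2 * \<i> * of_real (sin (pi * real k / real m)) * cis (pi * real k / real m)"
proof -
  have "zeta m ^ k = exp (of_nat k * (2 * of_real pi * \<i> / of_nat m))"
    unfolding zeta_def by (rule exp_of_nat_mult[symmetric])
  also have "of_nat k * (2 * of_real pi * \<i> / of_nat m) = \<i> * of_real (2 * (pi * real k / real m))"
    by simp
  also have "exp \<dots> = cis (2 * (pi * real k / real m))"
    by (simp only: cis_conv_exp)
  finally have z: "zeta m ^ k = cis (2 * (pi * real k / real m))" .
  have "1 - cis (2 * x) = - 2 * \<i> * of_real (sin x) * cis x" for x
    by (simp add: complex_eq_iff cos_double sin_double cos_squared_eq) (simp add: power2_eq_square)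
  then show ?thesis unfolding z .
qed

text \<open>Each factor is a sine times a phase, and the phases cancel because k1 + k2 = k3 +
  k4.\<close>

lemma f_quot_eq_sin:
  assumes m: "m > 0" and k: "k1 + k2 = k3 + k4"
  shows "f_quot m (k1, k2, k3, k4) = of_real
    ((sin (pi * real k1 / real m) * sin (pi * real k2 / real m)) /
     (sin (pi * real k3 / real m) * sin (pi * real k4 / real m)))"
proof -
  define s where "s k = complex_of_real (sin (pi * real k / real m))" for k
  define e where "e k = cis (pi * real k / real m)" for k
  have ee: "e i * e j = e (i + j)" for i j
    unfolding e_def cis_mult by (simp add: add_divide_distrib distrib_left)
  have z: "1 - zeta m ^ k = - 2 * \<i> * s k * e k" for k
    unfolding s_def e_def by (rule one_minus_zeta_power[OF m])
  have prod: "(1 - zeta m ^ i) * (1 - zeta m ^ j) = (- 4 * e (i + j)) * (s i * s j)" for i j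
    unfolding z ee[symmetric] by (simp add: algebra_simps)
  have "- 4 * e (k3 + k4) \<noteq> 0" by (simp add: e_def)
  then have "f_quot m (k1, k2, k3, k4) = (s k1 * s k2) / (s k3 * s k4)"
    unfolding f_quot_def prod.case prod k by (rule mult_divide_mult_cancel_left)
  then show ?thesis by (simp add: s_def)
qed

text \<open>\<open>D_set\<close> orders the numerator indices, hence min and max. The chain 1 <= c <
  a < d < n yields the level n >= 4.\<close>

lemma sin_quotient_in_C:
  fixes n a b c d :: int
  assumes k: "1 \<le> c" "c < a" "c < b" "a < d" "b < d" "d < n" "a + b = c + d"
  shows "complex_of_real ((sin (pi * of_int a / of_int n) * sin (pi * of_int b / of_int n)) /
     (sin (pi * of_int c / of_int n) * sin (pi * of_int d / of_int n))) \<in> (\<Union>m\<in>{4..}. C_level m)"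
proof -
  define m k1 k2 k3 k4 where "m = nat n" and "k1 = nat (min a b)" and "k2 = nat (max a b)"
    and "k3 = nat c" and "k4 = nat d"
  have D: "(k1, k2, k3, k4) \<in> D_set m"
    using k unfolding D_set_def m_def k1_def k2_def k3_def k4_def by auto
  have "k1 + k2 = k3 + k4" using D by (simp add: D_set_def)
  have real: "real m = of_int n" "real k1 = of_int (min a b)" "real k2 = of_int (max a b)"
    "real k3 = of_int c" "real k4 = of_int d"
    using k by (simp_all add: m_def k1_def k2_def k3_def k4_def)
  have "m > 0" using k by (simp add: m_def)
  have "f_quot m (k1, k2, k3, k4) = of_real ((sin (pi * of_int a / of_int n) * sin (pi * of_int b / of_int n)) /
     (sin (pi * of_int c / of_int n) * sin (pi * of_int d / of_int n)))"
    unfolding f_quot_eq_sin[OF \<open>m > 0\<close> \<open>k1 + k2 = k3 + k4\<close>] real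
    by (cases "a \<le> b") (simp_all add: min_def max_def mult.commute)
  moreover have "f_quot m (k1, k2, k3, k4) \<in> C_level m" using D by (auto simp: C_level_def)
  moreover have "m \<ge> 4" using k by (simp add: m_def)
  ultimately show ?thesis by auto
qed

text \<open>
  Here \<open>S i j\<close> are the signed areas spanned by four directions. Each \<open>c i\<close> is determined modulo
  \<open>n\<close> only; shifting it by \<open>n\<close> flips the sign of \<open>\<rho> i\<close>, and this freedom is used to move all
  of them into one period.
\<close>

lemma cross_ratio_of_sines_pos:
  fixes n :: int and c :: "nat \<Rightarrow> int" and \<rho> :: "nat \<Rightarrow> real" and S :: "nat \<Rightarrow> nat \<Rightarrow> real"
  assumes n: "n > 0" and \<Delta>: "\<Delta> > 0"
    and S: "\<And>i j. i < j \<Longrightarrow> j < 4 \<Longrightarrow> S i j > 0"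
    and rel: "\<And>i j. i < 4 \<Longrightarrow> j < 4 \<Longrightarrow> \<rho> i * \<rho> j * S i j = \<Delta> * sin (pi * of_int (c j - c i) / of_int n)"
    and \<rho>: "\<And>i. i < 4 \<Longrightarrow> \<rho> i \<noteq> 0"
  shows "complex_of_real (S 0 2 * S 1 3 / (S 1 2 * S 0 3)) \<in> (\<Union>m\<in>{4..}. C_level m)"
proof -
  define q where "q i = (c i - c 0) div n" for i
  define d where "d i = (c i - c 0) mod n" for i
  define \<sigma> where "\<sigma> i = \<rho> i * cos (pi * of_int (q i))" for i
  have npos: "real_of_int n > 0" using n by simp
  have "d 0 = 0" by (simp add: d_def)
  have dn: "0 \<le> d i" "d i < n" for i using n by (simp_all add: d_def)
  have cos1: "cos (pi * of_int k) * cos (pi * of_int k) = 1" for k :: int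
    using sin_cos_squared_add[of "pi * of_int k"] by (simp add: power2_eq_square)
  have relsin: "\<sigma> i * \<sigma> j * S i j = \<Delta> * sin (pi * of_int (d j - d i) / of_int n)" if "i < 4" "j < 4" for i j
  proof -
    have dc: "d i = c i - c 0 - n * q i" for i by (simp add: d_def q_def minus_mult_div_eq_mod)
    have "pi * of_int (d j - d i) / of_int n
        = pi * of_int (c j - c i) / of_int n - pi * of_int (q j - q i)"
      unfolding dc using npos by (simp add: field_simps)
    then have "sin (pi * of_int (d j - d i) / of_int n)
        = sin (pi * of_int (c j - c i) / of_int n) * cos (pi * of_int (q j - q i))"
      by (simp only: sin_diff sin_npi_int mult_zero_right diff_zero)
    also have "cos (pi * of_int (q j - q i)) = cos (pi * of_int (q i)) * cos (pi * of_int (q j))"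
      by (simp add: right_diff_distrib cos_diff mult.commute)
    finally show ?thesis using rel[OF that] by (simp add: \<sigma>_def mult_ac)
  qed
  have sin_sgn: "k > 0" if "sin (pi * of_int k / of_int n) > 0" "- n < k" for k
  proof (rule ccontr)
    assume "\<not> k > 0"
    define x where "x = - (pi * of_int k / of_int n)"
    have "pi * of_int (- k) < pi * of_int n" using that(2) by (intro mult_strict_left_mono) auto
    then have "0 \<le> x" "x \<le> pi"
      using \<open>\<not> k > 0\<close> npos by (simp_all add: x_def field_simps mult_le_0_iff)
    then have "sin x \<ge> 0" by (rule sin_ge_zero)
    with that show False by (simp add: x_def)
  qed
  have \<sigma>0: "\<sigma> i \<noteq> 0" if "i < 4" for i
    using \<rho>[OF that] cos1[of "q i"] by (auto simp: \<sigma>_def)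
  \<comment> \<open>All d i lie in [0, n), where the sine is nonnegative, so every \<sigma> i has
    the sign of \<sigma> 0. With equal signs, positive areas force the d i to increase.\<close>
  have pos0: "\<sigma> 0 * \<sigma> i > 0" if "0 < i" "i < 4" for i
  proof -
    have "\<sigma> 0 * \<sigma> i * S 0 i \<noteq> 0" using \<sigma>0[of 0] \<sigma>0[of i] S[of 0 i] that by auto
    then have "sin (pi * of_int (d i) / of_int n) \<noteq> 0" using relsin[of 0 i] that \<open>d 0 = 0\<close> by auto
    moreover have "sin (pi * of_int (d i) / of_int n) \<ge> 0"
      using dn[of i] npos by (intro sin_ge_zero) (auto simp: field_simps)
    ultimately have "\<sigma> 0 * \<sigma> i * S 0 i > 0" using relsin[of 0 i] that \<open>d 0 = 0\<close> \<Delta> by simp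
    with S[of 0 i] that show ?thesis by (simp add: zero_less_mult_iff)
  qed
  have pos: "\<sigma> i * \<sigma> j > 0" if "i < j" "j < 4" for i j
  proof (cases "i = 0")
    case False
    then have "\<sigma> 0 * \<sigma> i > 0" "\<sigma> 0 * \<sigma> j > 0" using pos0[of i] pos0[of j] that by simp_all
    then have "(\<sigma> 0 * \<sigma> i) * (\<sigma> 0 * \<sigma> j) > 0" by (rule mult_pos_pos)
    then have "(\<sigma> 0 * \<sigma> 0) * (\<sigma> i * \<sigma> j) > 0" by (simp add: mult_ac)
    then show ?thesis by (simp add: zero_less_mult_iff not_square_less_zero)
  qed (use pos0 that in auto)
  have mono: "d i < d j" if "i < j" "j < 4" for i j
  proof -
    have "\<Delta> * sin (pi * of_int (d j - d i) / of_int n) > 0"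
      using relsin[of i j] mult_pos_pos[OF pos[OF that] S[OF that]] that by simp
    then have "d j - d i > 0"
      using sin_sgn[of "d j - d i"] dn[of i] dn[of j] \<Delta> by (simp add: zero_less_mult_iff)
    then show ?thesis by simp
  qed
  define s where "s k = sin (pi * of_int k / of_int n)" for k :: int
  have Seq: "S i j = \<Delta> * s (d j - d i) / (\<sigma> i * \<sigma> j)" if "i < 4" "j < 4" for i j
    using relsin[OF that] \<sigma>0 that unfolding s_def by (simp add: field_simps)
  \<comment> \<open>Every index occurs once above and once below, so all \<sigma> i and \<Delta>
    cancel.\<close>
  have "S 0 2 * S 1 3 / (S 1 2 * S 0 3) = s (d 2 - d 0) * s (d 3 - d 1) / (s (d 2 - d 1) * s (d 3 - d 0))"
    using \<sigma>0[of 0] \<sigma>0[of 1] \<sigma>0[of 2] \<sigma>0[of 3] \<Delta> by (simp add: Seq mult_ac)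
  also have "complex_of_real \<dots> \<in> (\<Union>m\<in>{4..}. C_level m)"
    unfolding s_def using mono[of 0 1] mono[of 1 2] mono[of 2 3] dn[of 3] \<open>d 0 = 0\<close>
    by (intro sin_quotient_in_C) auto
  finally show ?thesis .
qed

text \<open>A negative \<Delta> means reversed orientation; replacing c by - c changes the sign of
  every sine.\<close>

lemma cross_ratio_of_sines:
  fixes n :: int and c :: "nat \<Rightarrow> int" and \<rho> :: "nat \<Rightarrow> real" and S :: "nat \<Rightarrow> nat \<Rightarrow> real"
  assumes n: "n > 0" and \<Delta>: "\<Delta> \<noteq> 0"
    and S: "\<And>i j. i < j \<Longrightarrow> j < 4 \<Longrightarrow> S i j > 0"
    and rel: "\<And>i j. i < 4 \<Longrightarrow> j < 4 \<Longrightarrow> \<rho> i * \<rho> j * S i j = \<Delta> * sin (pi * of_int (c j - c i) / of_int n)"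
    and \<rho>: "\<And>i. i < 4 \<Longrightarrow> \<rho> i \<noteq> 0"
  shows "complex_of_real (S 0 2 * S 1 3 / (S 1 2 * S 0 3)) \<in> (\<Union>m\<in>{4..}. C_level m)"
proof (cases "\<Delta> > 0")
  case True
  then show ?thesis using assms by (intro cross_ratio_of_sines_pos[of n \<Delta> S \<rho> c])
next
  case False
  have "\<rho> i * \<rho> j * S i j = - \<Delta> * sin (pi * of_int (- c j - - c i) / of_int n)" if "i < 4" "j < 4" for i j
  proof -
    have "pi * of_int (- c j - - c i) / of_int n = - (pi * of_int (c j - c i) / real_of_int n)"
      by (simp add: minus_divide_left algebra_simps)
    then show ?thesis using rel[OF that] by (simp only: sin_minus)
  qed
  moreover have "- \<Delta> > 0" using False \<Delta> by simp
  ultimately show ?thesis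
    using n S \<rho> by (intro cross_ratio_of_sines_pos[of n "- \<Delta>" S \<rho> "\<lambda>i. - c i"])
qed

section \<open>Angles of lines, slopes and their cross ratios\<close>

lemma of_real_cis_area:
  "Im (cnj (of_real r * cis \<alpha>) * (of_real s * cis \<beta>)) = r * s * sin (\<beta> - \<alpha>)"
  by (simp add: sin_diff algebra_simps)

text \<open>A shift of \<open>Arg\<close> by pi with a negated factor gives an angle in [0, pi). Two
  such angles differ by less than pi, and the sine of their difference is 0 because u spans no area
  with itself; so the \<open>THE\<close> is well defined.\<close>

lemma line_angle:
  assumes "u \<noteq> 0"
  shows "0 \<le> line_angle u" "line_angle u < pi" "\<exists>r. u = of_real r * cis (line_angle u)"
proof -
  let ?P = "\<lambda>\<theta>. 0 \<le> \<theta> \<and> \<theta> < pi \<and> (\<exists>r::real. u = of_real r * cis \<theta>)"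
  have polar: "u = of_real (cmod u) * cis (Arg u)"
    using rcis_cmod_Arg[of u] by (simp add: rcis_def)
  have shift: "of_real r * cis x = of_real (- r) * cis (x + pi)" "of_real r * cis x = of_real (- r) * cis (x - pi)" for r x
    by (simp_all add: complex_eq_iff)
  have "\<exists>\<theta>. ?P \<theta>"
  proof -
    consider "Arg u < 0" | "0 \<le> Arg u" "Arg u < pi" | "Arg u = pi"
      using Arg_bounded[of u] by linarith
    then show ?thesis
    proof cases
      case 1
      have "u = of_real (- cmod u) * cis (Arg u + pi)" using polar shift(1) by metis
      then have "\<exists>r. u = of_real r * cis (Arg u + pi)" by (rule exI)
      moreover have "0 \<le> Arg u + pi" "Arg u + pi < pi" using 1 Arg_bounded[of u] by linarith+
      ultimately show ?thesis by blast
    next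
      case 2
      then show ?thesis using polar by (intro exI[of _ "Arg u"]) blast
    next
      case 3
      have "u = of_real (- cmod u) * cis (Arg u - pi)" using polar shift(2) by metis
      then have "\<exists>r. u = of_real r * cis (Arg u - pi)" by (rule exI)
      moreover have "0 \<le> Arg u - pi" "Arg u - pi < pi" using 3 by simp_all
      ultimately show ?thesis by blast
    qed
  qed
  moreover have "\<theta> = \<theta>'" if P: "?P \<theta>" "?P \<theta>'" for \<theta> \<theta>'
  proof -
    obtain r r' where r: "u = of_real r * cis \<theta>" "u = of_real r' * cis \<theta>'" using P by blast
    have "r * r' * sin (\<theta>' - \<theta>) = Im (cnj u * u)"
      unfolding of_real_cis_area[symmetric] r[symmetric] ..
    also have "\<dots> = 0" by simp
    finally have "sin (\<theta>' - \<theta>) = 0" using r assms by auto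
    moreover have "- pi < \<theta>' - \<theta>" "\<theta>' - \<theta> < pi" using P by linarith+
    ultimately have "\<theta>' - \<theta> = 0" by (metis sin_eq_0_pi)
    then show ?thesis by simp
  qed
  ultimately have "\<exists>!\<theta>. ?P \<theta>" by blast
  from theI'[OF this] show "0 \<le> line_angle u" "line_angle u < pi" "\<exists>r. u = of_real r * cis (line_angle u)"
    unfolding line_angle_def by blast+
qed

lemma slope_eq: "slope z = (if Re z = 0 then Infty else Fin (Im z / Re z))"
proof -
  have "z + cnj z = of_real (2 * Re z)" "z - cnj z = of_real (2 * Im z) * \<i>"
    by (simp_all add: complex_eq_iff)
  then have "Re (- \<i> * (z - cnj z) / (z + cnj z)) = Im z / Re z"
    by (simp only:) (simp add: complex_eq_iff Re_divide power2_eq_square)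
  moreover have "z + cnj z = 0 \<longleftrightarrow> Re z = 0" by (simp add: complex_eq_iff)
  ultimately show ?thesis unfolding slope_def by simp
qed

text \<open>For nonvertical u and v, A u v is the difference of slopes times both real parts, and
  these cancel. Two vertical vectors would span area 0, so at most one is vertical; its imaginary
  part then cancels instead.\<close>

lemma cross_ratio_slopes:
  fixes a b c d :: complex
  defines "A \<equiv> \<lambda>u v. Im (cnj u * v)"
  assumes nz: "A a b \<noteq> 0" "A a c \<noteq> 0" "A a d \<noteq> 0" "A b c \<noteq> 0" "A b d \<noteq> 0" "A c d \<noteq> 0"
  shows "cross_ratio (slope a) (slope b) (slope c) (slope d) = (A a c * A b d) / (A b c * A a d)"
proof -
  have A: "A u v = Re u * Im v - Im u * Re v" for u v by (simp add: A_def)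
  define t where "t z = Im z / Re z" for z
  have A1: "A u v = Re u * Re v * (t v - t u)" if "Re u \<noteq> 0" "Re v \<noteq> 0" for u v
    using that by (simp add: A t_def field_simps)
  have sl: "slope z = (if Re z = 0 then Infty else Fin (t z))" for z by (simp add: slope_eq t_def)
  have one: "\<not> (Re u = 0 \<and> Re v = 0)" if "A u v \<noteq> 0" for u v using that by (auto simp: A)
  note ones = one[OF nz(1)] one[OF nz(2)] one[OF nz(3)] one[OF nz(4)] one[OF nz(5)] one[OF nz(6)]
  have t_ne: "t u \<noteq> t v" if "A u v \<noteq> 0" "Re u \<noteq> 0" "Re v \<noteq> 0" for u v
    using that by (auto simp: A1)
  consider "Re a = 0" "Re b \<noteq> 0" "Re c \<noteq> 0" "Re d \<noteq> 0"
    | "Re a \<noteq> 0" "Re b = 0" "Re c \<noteq> 0" "Re d \<noteq> 0"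
    | "Re a \<noteq> 0" "Re b \<noteq> 0" "Re c = 0" "Re d \<noteq> 0"
    | "Re a \<noteq> 0" "Re b \<noteq> 0" "Re c \<noteq> 0" "Re d = 0"
    | "Re a \<noteq> 0" "Re b \<noteq> 0" "Re c \<noteq> 0" "Re d \<noteq> 0"
    using ones by blast
  then show ?thesis
  proof cases
    case 1
    have "A a c = - Im a * Re c" "A a d = - Im a * Re d" using 1 by (simp_all add: A)
    moreover have "Im a \<noteq> 0" using nz(1) 1 by (auto simp: A)
    ultimately show ?thesis using 1 by (simp add: sl A1)
  next
    case 2
    have "A b c = - Im b * Re c" "A b d = - Im b * Re d" using 2 by (simp_all add: A)
    moreover have "Im b \<noteq> 0" using nz(1) 2 by (auto simp: A)
    ultimately show ?thesis using 2 by (simp add: sl A1)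
  next
    case 3
    have "A a c = Re a * Im c" "A b c = Re b * Im c" using 3 by (simp_all add: A)
    moreover have "Im c \<noteq> 0" using nz(2) 3 by (auto simp: A)
    ultimately show ?thesis using 3 by (simp add: sl A1)
  next
    case 4
    have "A a d = Re a * Im d" "A b d = Re b * Im d" using 4 by (simp_all add: A)
    moreover have "Im d \<noteq> 0" using nz(3) 4 by (auto simp: A)
    ultimately show ?thesis using 4 by (simp add: sl A1)
  next
    case 5
    then show ?thesis by (simp add: sl A1)
  qed
qed

lemma cross_ratio_angles:
  assumes u: "u1 \<noteq> 0" "u2 \<noteq> 0" "u3 \<noteq> 0" "u4 \<noteq> 0"
    and ord: "line_angle u1 < line_angle u2" "line_angle u2 < line_angle u3" "line_angle u3 < line_angle u4"
  shows "cross_ratio (slope u1) (slope u2) (slope u3) (slope u4) =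
    (sin (line_angle u3 - line_angle u1) * sin (line_angle u4 - line_angle u2)) /
    (sin (line_angle u3 - line_angle u2) * sin (line_angle u4 - line_angle u1))"
proof -
  obtain r1 where r1: "u1 = of_real r1 * cis (line_angle u1)" using line_angle(3)[OF u(1)] by blast
  obtain r2 where r2: "u2 = of_real r2 * cis (line_angle u2)" using line_angle(3)[OF u(2)] by blast
  obtain r3 where r3: "u3 = of_real r3 * cis (line_angle u3)" using line_angle(3)[OF u(3)] by blast
  obtain r4 where r4: "u4 = of_real r4 * cis (line_angle u4)" using line_angle(3)[OF u(4)] by blast
  have r0: "r1 \<noteq> 0" "r2 \<noteq> 0" "r3 \<noteq> 0" "r4 \<noteq> 0" using r1 r2 r3 r4 u by auto
  define t1 t2 t3 t4 where "t1 = line_angle u1" and "t2 = line_angle u2"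
    and "t3 = line_angle u3" and "t4 = line_angle u4"
  note t = t1_def[symmetric] t2_def[symmetric] t3_def[symmetric] t4_def[symmetric]
  have bounds: "0 \<le> t1" "t1 < t2" "t2 < t3" "t3 < t4" "t4 < pi"
    using ord line_angle(1)[OF u(1)] line_angle(2)[OF u(4)] by (simp_all add: t)
  have sin_ne: "sin (y - x) \<noteq> 0" if "0 < y - x" "y - x < pi" for x y :: real
    using sin_gt_zero[OF that] by simp
  have s: "sin (t2 - t1) \<noteq> 0" "sin (t3 - t1) \<noteq> 0" "sin (t4 - t1) \<noteq> 0"
    "sin (t3 - t2) \<noteq> 0" "sin (t4 - t2) \<noteq> 0" "sin (t4 - t3) \<noteq> 0"
    by (rule sin_ne; use bounds in linarith)+
  \<comment> \<open>The equation \<open>r1\<close> has u1 on both sides, inside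
    \<open>line_angle u1\<close> on the right. Copies with named angles can be unfolded
    safely.\<close>
  define v1 v2 v3 v4 where "v1 = of_real r1 * cis t1" and "v2 = of_real r2 * cis t2"
    and "v3 = of_real r3 * cis t3" and "v4 = of_real r4 * cis t4"
  have v: "u1 = v1" "u2 = v2" "u3 = v3" "u4 = v4"
    using r1 r2 r3 r4 by (simp_all add: v1_def v2_def v3_def v4_def t)
  have "cross_ratio (slope v1) (slope v2) (slope v3) (slope v4) =
    (Im (cnj v1 * v3) * Im (cnj v2 * v4)) / (Im (cnj v2 * v3) * Im (cnj v1 * v4))"
    unfolding v1_def v2_def v3_def v4_def
    by (rule cross_ratio_slopes; unfold of_real_cis_area; use r0 s in simp)
  also have "\<dots> = (sin (t3 - t1) * sin (t4 - t2)) / (sin (t3 - t2) * sin (t4 - t1))"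
    unfolding v1_def v2_def v3_def v4_def of_real_cis_area using r0 by simp
  finally show ?thesis unfolding t v[symmetric] .
qed

text \<open>A three-term Pluecker relation. Equal cross ratios for fourth directions at angles x and
  y make the left side 0, hence sin (x - y) = 0.\<close>

lemma sin_cross_identity:
  "sin (x - b) * sin (y - a) - sin (y - b) * sin (x - a) = sin (x - y) * sin (b - a)" for a b x y :: real
proof -
  have "sin v * sin (w - z) - sin w * sin (v - z) = sin (v - w) * sin (- z)" for v w z :: real
    by (simp add: sin_diff algebra_simps)
  from this[of "x - b" "y - b" "a - b"] show ?thesis by simp
qed

section \<open>Integer polynomials and conjugates\<close>

hide_const (open) Module.smult up_ring.monom up_ring.coeff Divisibility.prime Divisibility.irreducible Polynomials.degree Polynomials.lead_coeff

abbreviation cpoly :: "int poly \<Rightarrow> complex poly" where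
  "cpoly \<equiv> map_poly of_int"

lemma cpoly_hom [simp]:
  "cpoly (p + q) = cpoly p + cpoly q" "cpoly (p - q) = cpoly p - cpoly q"
  "cpoly (p * q) = cpoly p * cpoly q" "cpoly (smult c p) = smult (of_int c) (cpoly p)"
  "cpoly (monom c n) = monom (of_int c) n" "cpoly 1 = 1" "cpoly [:c:] = [:of_int c:]"
  "cpoly (p ^ n) = cpoly p ^ n"
proof -
  show mult: "cpoly (p * q) = cpoly p * cpoly q" for p q
    by (rule poly_eqI) (simp add: coeff_map_poly coeff_mult)
  show "cpoly (p ^ n) = cpoly p ^ n"
    by (induction n) (simp_all add: mult)
qed (rule poly_eqI; simp add: coeff_map_poly coeff_pCons split: nat.splits)+

lemma degree_cpoly [simp]: "degree (cpoly p) = degree p"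
  by (rule degree_map_poly) simp

lemma cpoly_eq_0_iff [simp]: "cpoly p = 0 \<longleftrightarrow> p = 0"
  by (rule map_poly_eq_0_iff) auto

lemma poly_cpoly_of_int: "poly (cpoly p) (of_int k) = of_int (poly p k)"
  by (induction p) (simp_all add: map_poly_pCons)

text \<open>Pseudo-division by some r of least degree with root z shows that r divides a nonzero
  integer multiple of every polynomial vanishing at z. Comparing degrees, p divides r; being prime
  and no divisor of a nonzero constant, p divides q. So p acts as the primitive minimal polynomial
  of z.\<close>

lemma prime_elem_dvd_of_common_root:
  fixes p q :: "int poly"
  assumes p: "prime_elem p" "poly (cpoly p) z = 0" and q: "poly (cpoly q) z = 0"
  shows "p dvd q"
proof -
  define S where "S r \<longleftrightarrow> r \<noteq> 0 \<and> poly (cpoly r) z = 0" for r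
  have "S p" using p by (auto simp: S_def)
  then obtain r where r: "S r" "\<And>t. S t \<Longrightarrow> degree r \<le> degree t"
    using ex_has_least_nat[of S p degree] by blast
  have div: "\<exists>c s. c \<noteq> 0 \<and> smult c t = r * s" if t: "poly (cpoly t) z = 0" for t
  proof -
    have "r \<noteq> 0" using r by (auto simp: S_def)
    from pseudo_mod[OF this, of t] obtain a s where
      as: "a \<noteq> 0" "smult a t = r * s + pseudo_mod t r"
      and d: "pseudo_mod t r = 0 \<or> degree (pseudo_mod t r) < degree r" by auto
    have "poly (cpoly (smult a t)) z = poly (cpoly (r * s + pseudo_mod t r)) z"
      using as by simp
    then have "poly (cpoly (pseudo_mod t r)) z = 0"
      using r t by (simp add: S_def)
    with r d have "pseudo_mod t r = 0" by (force simp: S_def)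
    with as show ?thesis by auto
  qed
  have not_const: "\<not> p dvd [:c:]" if "c \<noteq> 0" for c
  proof
    assume "p dvd [:c:]"
    then obtain s where "[:c:] = p * s" ..
    then have "poly (cpoly [:c:]) z = poly (cpoly (p * s)) z" by simp
    with p that show False by simp
  qed
  obtain c s where c: "c \<noteq> 0" "smult c p = r * s" using div p by blast
  have "p dvd r * s" using c by (metis dvd_smult dvd_refl)
  have "\<not> p dvd s"
  proof
    assume "p dvd s"
    then have "degree p \<le> degree s"
      using c p by (intro dvd_imp_degree_le) auto
    moreover have "degree p = degree r + degree s"
      using c by (metis degree_mult_eq degree_smult_eq mult_eq_0_iff p(1) prime_elem_not_zeroI smult_eq_0_iff)
    ultimately have "degree r = 0" by simp
    then obtain d where "r = [:d:]" by (rule degree_eq_zeroE)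
    with r show False by (auto simp: S_def)
  qed
  with \<open>p dvd r * s\<close> p have "p dvd r" by (auto simp: prime_elem_dvd_mult_iff)
  obtain c s where c: "c \<noteq> 0" "smult c q = r * s" using div q by blast
  have "p dvd [:c:] * q" using c \<open>p dvd r\<close> by simp
  then have "p dvd [:c:] \<or> p dvd q" using p(1) by (rule prime_elem_dvd_multD[rotated])
  with not_const[OF c(1)] show ?thesis by blast
qed

lemma prime_factor_with_root:
  fixes q :: "int poly"
  assumes "q \<noteq> 0" "poly (cpoly q) z = 0"
  shows "\<exists>p. prime_elem p \<and> p dvd q \<and> poly (cpoly p) z = 0"
  using assms
proof (induction q rule: prime_divisors_induct)
  case (unit q)
  then obtain s where "1 = q * s" by (auto simp: dvd_def)
  then have "poly (cpoly 1) z = poly (cpoly (q * s)) z" by simp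
  with unit show ?case by simp
next
  case (factor p q)
  show ?case
  proof (cases "poly (cpoly p) z = 0")
    case True
    with factor show ?thesis by (intro exI[of _ p]) (auto simp: prime_def)
  next
    case False
    with factor show ?thesis by (auto intro: dvd_mult)
  qed
qed simp

section \<open>Products over the conjugates of a root of unity\<close>

lemma poly_cpoly_pcompose:
  "poly (cpoly (pcompose p q)) z = poly (cpoly p) (poly (cpoly q) z)"
  by (induction p) (simp_all add: pcompose_pCons map_poly_pCons)

text \<open>X^m - 1 is monic with m distinct roots; counting the roots of both factors leaves \<Psi>
  with as many roots as its degree.\<close>

lemma conjugates_card_and_lead_coeff:
  assumes \<Psi>: "\<Psi> dvd monom 1 m - (1::int poly)" and m: "m \<ge> 1"
  shows "card {z. poly (cpoly \<Psi>) z = 0} = degree \<Psi>" "is_unit (lead_coeff \<Psi>)"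
proof -
  let ?Q = "monom 1 m - (1::int poly)"
  obtain s where s: "?Q = \<Psi> * s" using \<Psi> ..
  have d: "degree ?Q = m"
    using m by (intro antisym degree_diff_le le_degree) (simp_all add: degree_monom_le coeff_1)
  then have Q0: "?Q \<noteq> 0" using m by auto
  then have nz: "\<Psi> \<noteq> 0" "s \<noteq> 0" using s by auto
  have "lead_coeff ?Q = 1" using d m by (simp add: coeff_1)
  then show "is_unit (lead_coeff \<Psi>)"
    unfolding s lead_coeff_mult by (metis dvd_triv_left)
  have "{z. poly (cpoly ?Q) z = 0} = {z::complex. z ^ m = 1}"
    by (auto simp: poly_monom)
  then have "m = card {z. poly (cpoly ?Q) z = 0}" using m card_complex_roots_unity by simp
  also have "{z. poly (cpoly ?Q) z = 0} = {z. poly (cpoly \<Psi>) z = 0} \<union> {z. poly (cpoly s) z = 0}"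
    unfolding s by auto
  also have "card \<dots> \<le> card {z. poly (cpoly \<Psi>) z = 0} + card {z. poly (cpoly s) z = 0}"
    by (rule card_Un_le)
  also have "card {z. poly (cpoly s) z = 0} \<le> degree s"
    using card_poly_roots_bound[of "cpoly s"] nz by simp
  finally have "m \<le> card {z. poly (cpoly \<Psi>) z = 0} + degree s" by simp
  moreover have "m = degree \<Psi> + degree s"
    using d s nz by (simp add: degree_mult_eq)
  moreover have "card {z. poly (cpoly \<Psi>) z = 0} \<le> degree \<Psi>"
    using card_poly_roots_bound[of "cpoly \<Psi>"] nz by simp
  ultimately show "card {z. poly (cpoly \<Psi>) z = 0} = degree \<Psi>" by simp
qed

text \<open>The remainder of w modulo \<Psi> has integer coefficients and, up to sign, the value c
  at more points than its degree. So it is constant, and c is an integer.\<close>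

lemma constant_on_conjugates_in_Ints:
  assumes card: "card {z. poly (cpoly \<Psi>) z = 0} = degree \<Psi>"
    and unit: "is_unit (lead_coeff \<Psi>)" and deg: "degree \<Psi> > 0"
    and c: "\<And>z. poly (cpoly \<Psi>) z = 0 \<Longrightarrow> poly (cpoly w) z = c"
  shows "c \<in> \<int>"
proof -
  obtain q r where qr: "pseudo_divmod w \<Psi> = (q, r)" by force
  have \<Psi>0: "\<Psi> \<noteq> 0" using deg by auto
  define a where "a = lead_coeff \<Psi> ^ (Suc (degree w) - degree \<Psi>)"
  have a: "Polynomial.smult a w = \<Psi> * q + r" "r = 0 \<or> degree r < degree \<Psi>"
    using pseudo_divmod[OF \<Psi>0 qr] by (simp_all add: a_def)
  have "is_unit a" using unit by (simp add: a_def power_abs)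
  then have "a = 1 \<or> a = -1" by auto
  then have "a * a = 1" by auto
  have r: "poly (cpoly r) z = of_int a * c" if "poly (cpoly \<Psi>) z = 0" for z
  proof -
    have "poly (cpoly (Polynomial.smult a w)) z = poly (cpoly (\<Psi> * q + r)) z" using a by simp
    with that c[OF that] show ?thesis by simp
  qed
  define p where "p = cpoly r - [:of_int a * c:]"
  have "p = 0"
  proof (rule ccontr)
    assume "p \<noteq> 0"
    have "degree \<Psi> \<le> card {z. poly p z = 0}"
      unfolding card[symmetric] using \<open>p \<noteq> 0\<close> r
      by (intro card_mono poly_roots_finite) (auto simp: p_def)
    also have "\<dots> \<le> degree p" by (rule card_poly_roots_bound) fact
    also have "\<dots> < degree \<Psi>"
      unfolding p_def using a deg by (intro degree_diff_less) auto
    finally show False by simp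
  qed
  then have "coeff (cpoly r) 0 = of_int a * c"
    by (simp add: p_def)
  then have "of_int (a * coeff r 0) = of_int (a * a) * c" by (simp add: coeff_map_poly)
  with \<open>a * a = 1\<close> show ?thesis by (metis Ints_of_int mult_1 of_int_1)
qed

text \<open>With the conjugates written as powers z^t, a coefficient of the product is one integer
  polynomial in z, valid for every z.\<close>

lemma coeff_prod_is_int_poly:
  assumes "finite T"
  shows "\<exists>w. \<forall>z. coeff (\<Prod>t\<in>T. [:- poly (cpoly N) (z ^ t), poly (cpoly M) (z ^ t):]) j
                = poly (cpoly w) z"
  using assms
proof (induction T arbitrary: j)
  case empty
  show ?case by (rule exI[of _ "[:if j = 0 then 1 else 0:]"]) (simp add: coeff_1)
next
  case (insert t T)
  let ?P = "\<lambda>z. \<Prod>t\<in>T. [:- poly (cpoly N) (z ^ t), poly (cpoly M) (z ^ t):]"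
  obtain w where w: "\<And>j z. coeff (?P z) j = poly (cpoly (w j)) z"
    using insert.IH by metis
  show ?case
    using insert.hyps
    by (intro exI[of _ "pcompose (- N) (monom 1 t) * w j +
          (case j of 0 \<Rightarrow> 0 | Suc i \<Rightarrow> pcompose M (monom 1 t) * w i)"])
       (auto simp: w coeff_pCons poly_cpoly_pcompose poly_monom pcompose_uminus
             split: nat.splits)
qed

text \<open>For every root z of \<Psi>, the powers z^t with t in T run through all roots. So each
  coefficient of the product is an integer polynomial in z that is constant on the roots.\<close>

lemma prod_over_conjugates_integral:
  fixes \<zeta> :: complex
  assumes \<zeta>: "\<zeta> ^ m = 1" "inj_on (\<lambda>t. \<zeta> ^ t) {..<m}" and m: "m \<ge> 1"
    and \<Psi>: "prime_elem \<Psi>" "\<Psi> dvd monom 1 m - 1" "poly (cpoly \<Psi>) \<zeta> = 0"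
  shows "\<exists>R. cpoly R = (\<Prod>z | poly (cpoly \<Psi>) z = 0. [:- poly (cpoly N) z, poly (cpoly M) z:])"
proof -
  define Z where "Z = {z. poly (cpoly \<Psi>) z = 0}"
  define T where "T = {t. t < m \<and> \<zeta> ^ t \<in> Z}"
  have fT: "finite T" by (simp add: T_def)
  have "\<Psi> \<noteq> 0" using \<Psi> by auto
  have fZ: "finite Z" unfolding Z_def using \<open>\<Psi> \<noteq> 0\<close> by (intro poly_roots_finite) simp
  have card: "card Z = degree \<Psi>" and unit: "is_unit (lead_coeff \<Psi>)"
    using conjugates_card_and_lead_coeff[OF \<Psi>(2) m] by (simp_all add: Z_def)
  \<comment> \<open>The roots of \<Psi> satisfy the same integer relations; this plays the part of
    the Galois action.\<close>
  have conj: "poly (cpoly q) z' = 0" if "poly (cpoly q) z = 0" "z \<in> Z" "z' \<in> Z" for q z z'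
    using prime_elem_dvd_of_common_root[OF \<Psi>(1) _ that(1)] that by (auto simp: Z_def elim!: dvdE)
  have \<zeta>Z: "\<zeta> \<in> Z" using \<Psi> by (simp add: Z_def)
  then have deg: "degree \<Psi> > 0" using card fZ card_gt_0_iff by fastforce
  have "(\<lambda>t. \<zeta> ^ t) ` {..<m} \<subseteq> {z. z ^ m = 1}"
    using \<zeta> by (auto simp: power_mult[symmetric] mult.commute[of _ m]) (simp add: power_mult)
  then have pow: "(\<lambda>t. \<zeta> ^ t) ` {..<m} = {z. z ^ m = 1}"
    using m card_complex_roots_unity[of m]
    by (intro card_subset_eq) (auto simp: card_image[OF \<zeta>(2)] finite_roots_unity)
  have "Z \<subseteq> {z. z ^ m = 1}"
  proof
    fix z assume "z \<in> Z"
    obtain s where "monom 1 m - 1 = \<Psi> * s" using \<Psi> by auto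
    then have "poly (cpoly (monom 1 m - 1)) z = poly (cpoly (\<Psi> * s)) z" by simp
    with \<open>z \<in> Z\<close> show "z \<in> {z. z ^ m = 1}" by (simp add: Z_def poly_monom)
  qed
  then have im1: "(\<lambda>t. \<zeta> ^ t) ` T = Z" using pow by (auto simp: T_def)
  have inj1: "inj_on (\<lambda>t. \<zeta> ^ t) T" using \<zeta>(2) by (rule inj_on_subset) (auto simp: T_def)
  have bij: "bij_betw (\<lambda>t. z ^ t) T Z" if z: "z \<in> Z" for z
  proof -
    have inj: "inj_on (\<lambda>t. z ^ t) T"
    proof (rule inj_onI)
      fix t t' assume tt: "t \<in> T" "t' \<in> T" "z ^ t = z ^ t'"
      then have "poly (cpoly (monom 1 t - monom 1 t')) z = 0" by (simp add: poly_monom)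
      from conj[OF this z \<zeta>Z] have "\<zeta> ^ t = \<zeta> ^ t'" by (simp add: poly_monom)
      with inj1 tt show "t = t'" by (auto dest: inj_onD)
    qed
    have "(\<lambda>t. z ^ t) ` T \<subseteq> Z"
    proof (intro image_subsetI)
      fix t assume "t \<in> T"
      then have "poly (cpoly (pcompose \<Psi> (monom 1 t))) \<zeta> = 0"
        by (simp add: T_def Z_def poly_cpoly_pcompose poly_monom)
      from conj[OF this \<zeta>Z z] show "z ^ t \<in> Z"
        by (simp add: Z_def poly_cpoly_pcompose poly_monom)
    qed
    moreover have "card ((\<lambda>t. z ^ t) ` T) = card Z"
      using card_image[OF inj] card_image[OF inj1] im1 by simp
    ultimately show ?thesis using inj fZ by (simp add: bij_betw_def card_subset_eq)
  qed
  define P where "P = (\<Prod>z\<in>Z. [:- poly (cpoly N) z, poly (cpoly M) z:])"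
  have "coeff P j \<in> \<int>" for j
  proof -
    obtain w where w: "\<And>z. coeff (\<Prod>t\<in>T. [:- poly (cpoly N) (z ^ t), poly (cpoly M) (z ^ t):]) j
        = poly (cpoly w) z" using coeff_prod_is_int_poly[OF fT] by blast
    have "poly (cpoly w) z = coeff P j" if "z \<in> Z" for z
      unfolding w[symmetric] P_def
      by (rule arg_cong[where f = "\<lambda>p. coeff p j"]) (rule prod.reindex_bij_betw[OF bij[OF that]])
    then show ?thesis
      using card unit deg by (intro constant_on_conjugates_in_Ints[of \<Psi> w]) (auto simp: Z_def)
  qed
  then show ?thesis using intpolyE[of P] by (metis P_def Z_def)
qed

text \<open>Makes g(N/M) = 0 an integer polynomial relation in z, which passes from \<zeta> to its
  conjugates.\<close>

lemma clear_denominators: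
  "\<exists>H e. \<forall>z. poly (cpoly M) z \<noteq> 0 \<longrightarrow>
     poly (cpoly H) z = poly (cpoly M) z ^ e * poly (cpoly g) (poly (cpoly N) z / poly (cpoly M) z)"
proof (induction g)
  case 0
  show ?case by (rule exI[of _ 0]) simp
next
  case (pCons a g)
  then obtain H e where "\<forall>z. poly (cpoly M) z \<noteq> 0 \<longrightarrow>
     poly (cpoly H) z = poly (cpoly M) z ^ e * poly (cpoly g) (poly (cpoly N) z / poly (cpoly M) z)"
    by blast
  then have H: "poly (cpoly H) z = poly (cpoly M) z ^ e * poly (cpoly g) (poly (cpoly N) z / poly (cpoly M) z)"
    if "poly (cpoly M) z \<noteq> 0" for z using that by blast
  have alg: "a * m ^ Suc e + n * (m ^ e * x) = m ^ Suc e * (a + n / m * x)"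
    if "m \<noteq> 0" for a m n x :: complex
    using that by (simp add: distrib_left)
  show ?case
  proof (intro exI allI impI)
    fix z assume z: "poly (cpoly M) z \<noteq> 0"
    show "poly (cpoly ([:a:] * M ^ Suc e + N * H)) z =
        poly (cpoly M) z ^ Suc e * poly (cpoly (pCons a g)) (poly (cpoly N) z / poly (cpoly M) z)"
      using alg[OF z] by (simp add: H[OF z] map_poly_pCons del: power_Suc)
  qed
qed

lemma value_bound_of_quotient_root:
  fixes \<zeta> :: complex and B k :: int
  assumes \<zeta>: "\<zeta> ^ m = 1" "inj_on (\<lambda>t. \<zeta> ^ t) {..<m}" and m: "m \<ge> 1"
    and M: "poly (cpoly M) \<zeta> \<noteq> 0"
    and bound: "\<And>z. norm z = 1 \<Longrightarrow> norm (poly (cpoly M) z * of_int k - poly (cpoly N) z) \<le> of_int B"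
    and g: "prime_elem g" "poly (cpoly g) (poly (cpoly N) \<zeta> / poly (cpoly M) \<zeta>) = 0"
  shows "\<bar>poly g k\<bar> \<le> B ^ degree g"
proof -
  have "monom 1 m - (1::int poly) \<noteq> 0"
  proof -
    have "coeff (monom 1 m - (1::int poly)) m = 1" using m by (simp add: coeff_1)
    then show ?thesis by (metis coeff_0 zero_neq_one)
  qed
  moreover have "poly (cpoly (monom 1 m - 1)) \<zeta> = 0" using \<zeta> by (simp add: poly_monom)
  ultimately obtain \<Psi> where \<Psi>: "prime_elem \<Psi>" "\<Psi> dvd monom 1 m - 1" "poly (cpoly \<Psi>) \<zeta> = 0"
    using prime_factor_with_root by blast
  define Z where "Z = {z. poly (cpoly \<Psi>) z = 0}"
  have "\<Psi> \<noteq> 0" using \<Psi> by auto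
  then have fZ: "finite Z" unfolding Z_def by (intro poly_roots_finite) simp
  have \<zeta>Z: "\<zeta> \<in> Z" using \<Psi> by (simp add: Z_def)
  have Z1: "norm z = 1" if "z \<in> Z" for z
  proof -
    obtain s where "monom 1 m - 1 = \<Psi> * s" using \<Psi> by auto
    then have "poly (cpoly (monom 1 m - 1)) z = poly (cpoly (\<Psi> * s)) z" by simp
    with that have "z ^ m = 1" by (simp add: Z_def poly_monom)
    then have "norm z ^ m = 1" by (simp flip: norm_power)
    then show ?thesis using m power_eq_imp_eq_base[of "norm z" m 1] by simp
  qed
  have conj: "poly (cpoly q) z = 0" if "poly (cpoly q) \<zeta> = 0" "z \<in> Z" for q z
    using prime_elem_dvd_of_common_root[OF \<Psi>(1,3) that(1)] that(2) by (auto simp: Z_def elim!: dvdE)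
  have conj': "poly (cpoly q) \<zeta> = 0" if "poly (cpoly q) z = 0" "z \<in> Z" for q z
    using prime_elem_dvd_of_common_root[OF \<Psi>(1) _ that(1)] that(2) \<Psi>(3)
    by (auto simp: Z_def elim!: dvdE)
  have MZ: "poly (cpoly M) z \<noteq> 0" if "z \<in> Z" for z
    using conj'[OF _ that, of M] M by argo
  have gZ: "poly (cpoly g) (poly (cpoly N) z / poly (cpoly M) z) = 0" if "z \<in> Z" for z
  proof -
    obtain H e where H: "\<And>z. poly (cpoly M) z \<noteq> 0 \<Longrightarrow>
      poly (cpoly H) z = poly (cpoly M) z ^ e * poly (cpoly g) (poly (cpoly N) z / poly (cpoly M) z)"
      using clear_denominators[of M g N] by blast
    have "poly (cpoly H) \<zeta> = 0" using H[OF M] g by simp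
    from conj[OF this that] H[OF MZ[OF that]] MZ[OF that] show ?thesis by simp
  qed
  obtain R where R: "cpoly R = (\<Prod>z\<in>Z. [:- poly (cpoly N) z, poly (cpoly M) z:])"
    using prod_over_conjugates_integral[OF \<zeta> m \<Psi>] unfolding Z_def by blast
  have degR: "degree R = card Z"
  proof -
    have "degree (cpoly R) = (\<Sum>z\<in>Z. degree [:- poly (cpoly N) z, poly (cpoly M) z:])"
      unfolding R using MZ by (intro degree_prod_eq_sum_degree) auto
    also have "\<dots> = (\<Sum>z\<in>Z. 1)" using MZ by (intro sum.cong) auto
    finally show ?thesis by simp
  qed
  have "cpoly R \<noteq> 0" unfolding R using MZ by (simp add: fZ)
  then have "R \<noteq> 0" by auto
  have "\<not> is_unit g" using g by (simp add: prime_elem_def)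
  obtain r h where h: "R = g ^ r * h" "\<not> g dvd h"
    by (rule multiplicity_decompose'[OF \<open>R \<noteq> 0\<close> \<open>\<not> is_unit g\<close>])
  have "h \<noteq> 0" "g \<noteq> 0" using h \<open>R \<noteq> 0\<close> g by auto
  \<comment> \<open>A root of h is a root of R, so some N(z) / M(z), so a root of g; then g would
    divide h.\<close>
  have "degree h = 0"
  proof (rule ccontr)
    assume "degree h \<noteq> 0"
    then have "\<not> constant (poly (cpoly h))" by (simp add: constant_degree)
    then obtain y where y: "poly (cpoly h) y = 0" using fundamental_theorem_of_algebra by blast
    then have "poly (cpoly R) y = 0" by (subst h) simp
    then obtain z where z: "z \<in> Z" "y * poly (cpoly M) z = poly (cpoly N) z"
      unfolding R using fZ by (auto simp: poly_prod)
    then have "y = poly (cpoly N) z / poly (cpoly M) z" using MZ by (simp add: field_simps)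
    with gZ z have "poly (cpoly g) y = 0" by simp
    with prime_elem_dvd_of_common_root[OF g(1) this y] h show False by simp
  qed
  then obtain c where c: "h = [:c:]" by (rule degree_eq_zeroE)
  then have "c \<noteq> 0" using \<open>h \<noteq> 0\<close> by simp
  have "card Z = r * degree g"
    unfolding degR[symmetric] h(1) using \<open>h \<noteq> 0\<close> \<open>g \<noteq> 0\<close> \<open>degree h = 0\<close>
    by (simp add: degree_mult_eq degree_power_eq)
  have "r > 0"
  proof -
    have "card Z > 0" using fZ \<zeta>Z card_gt_0_iff by blast
    with \<open>card Z = r * degree g\<close> show ?thesis by (cases r) auto
  qed
  have "of_int (\<bar>poly g k\<bar> ^ r) \<le> real_of_int (\<bar>poly R k\<bar>)"
  proof -
    have "\<bar>poly R k\<bar> = \<bar>poly g k\<bar> ^ r * \<bar>c\<bar>"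
      by (subst h) (simp add: c abs_mult power_abs)
    moreover have "\<bar>poly g k\<bar> ^ r * 1 \<le> \<bar>poly g k\<bar> ^ r * \<bar>c\<bar>"
      using \<open>c \<noteq> 0\<close> by (intro mult_left_mono) auto
    ultimately show ?thesis by linarith
  qed
  also have "\<dots> = norm (poly (cpoly R) (of_int k))" by (simp add: poly_cpoly_of_int)
  also have "\<dots> = (\<Prod>z\<in>Z. norm (poly (cpoly M) z * of_int k - poly (cpoly N) z))"
    unfolding R poly_prod by (simp add: prod_norm[symmetric] mult.commute)
  also have "\<dots> \<le> (\<Prod>z\<in>Z. of_int B)"
    using bound Z1 by (intro prod_mono) auto
  also have "\<dots> = of_int ((B ^ degree g) ^ r)"
    by (simp add: \<open>card Z = r * degree g\<close> mult.commute flip: power_mult)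
  finally have "\<bar>poly g k\<bar> ^ r \<le> (B ^ degree g) ^ r" by linarith
  \<comment> \<open>Comparing r-th powers needs B >= 0, which the bound at z = 1 provides.\<close>
  moreover have "real_of_int B \<ge> 0" using bound[of 1] norm_ge_zero by (rule order_trans[rotated]) simp
  then have "B \<ge> 0" by simp
  ultimately show ?thesis using \<open>r > 0\<close> by (simp add: power_mono_iff)
qed

text \<open>A polynomial of degree at most D is determined by its values at the D + 1 points 0, ...,
  D, and these lie in finite integer intervals.\<close>

lemma finite_int_polys_of_bounded_values:
  fixes B :: "nat \<Rightarrow> int"
  shows "finite {g. degree g \<le> D \<and> (\<forall>k\<le>D. \<bar>poly g (int k)\<bar> \<le> B k)}" (is "finite ?G")
proof (rule finite_imageD)
  let ?ev = "\<lambda>g::int poly. \<lambda>k\<in>{..D}. poly g (int k)"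
  show "finite (?ev ` ?G)"
  proof (rule finite_subset)
    show "?ev ` ?G \<subseteq> PiE {..D} (\<lambda>k. {-B k..B k})"
    proof (intro image_subsetI restrict_PiE_iff[THEN iffD2] ballI)
      fix g k assume "g \<in> ?G" "k \<in> {..D}"
      then have "\<bar>poly g (int k)\<bar> \<le> B k" by auto
      then show "poly g (int k) \<in> {-B k..B k}" by (simp add: abs_le_iff)
    qed
  qed (intro finite_PiE; simp)
  show "inj_on ?ev ?G"
  proof (rule inj_onI)
    fix p q assume pq: "p \<in> ?G" "q \<in> ?G" "?ev p = ?ev q"
    have eq: "poly p (int k) = poly q (int k)" if "k \<le> D" for k
      using fun_cong[OF pq(3), of k] that by simp
    show "p = q"
    proof (rule poly_eqI_degree)
      show "poly p x = poly q x" if "x \<in> int ` {..D}" for x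
        using that eq by auto
      have "card (int ` {..D}) = Suc D" by (simp add: card_image)
      then show "card (int ` {..D}) > degree p" "card (int ` {..D}) > degree q" using pq by auto
    qed
  qed
qed

section \<open>Finiteness of the set of cyclotomic quotients\<close>

interpretation CF: cring "complex_field"
  by (rule cring_from_type_algebra)

lemma complex_field_sel [simp]:
  "carrier complex_field = UNIV" "monoid.mult complex_field = (*)"
  "one complex_field = 1" "zero complex_field = 0" "add complex_field = (+)"
  by (simp_all add: ring_of_type_algebra_def)

lemma complex_field_a_inv [simp]: "a_inv complex_field x = - x"
  using CF.minus_equality[of "- x" x] by simp

lemma complex_field_m_inv [simp]: "x \<noteq> 0 \<Longrightarrow> m_inv complex_field x = inverse x"
  using CF.comm_inv_char[of x "inverse x"] by simp

lemma K_field_closed: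
  shows "1 \<in> K_field \<Lambda>"
    and "x \<in> K_field \<Lambda> \<Longrightarrow> y \<in> K_field \<Lambda> \<Longrightarrow> x - y \<in> K_field \<Lambda>"
    and "x \<in> K_field \<Lambda> \<Longrightarrow> y \<in> K_field \<Lambda> \<Longrightarrow> x * y \<in> K_field \<Lambda>"
    and "x \<in> K_field \<Lambda> \<Longrightarrow> y \<in> K_field \<Lambda> \<Longrightarrow> x / y \<in> K_field \<Lambda>"
proof -
  let ?H = "differences \<Lambda> \<union> cnj ` differences \<Lambda>"
  note gen = generate_field.intros[where R = complex_field and H = ?H, simplified]
  show one: "1 \<in> K_field \<Lambda>" using gen by (simp add: K_field_def)
  have zero: "0 \<in> K_field \<Lambda>" using gen(5)[OF gen(1) gen(3)[OF gen(1)]] by (simp add: K_field_def)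
  show mult: "x * y \<in> K_field \<Lambda>" if "x \<in> K_field \<Lambda>" "y \<in> K_field \<Lambda>" for x y
    using that gen(6) by (simp add: K_field_def)
  show "x - y \<in> K_field \<Lambda>" if "x \<in> K_field \<Lambda>" "y \<in> K_field \<Lambda>"
    using that gen(5)[of x "- y"] gen(3)[of y] by (simp add: K_field_def)
  show "x / y \<in> K_field \<Lambda>" if "x \<in> K_field \<Lambda>" "y \<in> K_field \<Lambda>"
  proof (cases "y = 0")
    case False
    with that gen(4)[of y] have "inverse y \<in> K_field \<Lambda>" by (simp add: K_field_def)
    with that mult show ?thesis by (simp add: divide_inverse)
  qed (use zero in simp)
qed

lemma Rats_subfield: "subfield \<rat> complex_field"
proof (rule field.subfieldI'[OF field_from_type_algebra])
  show "subring \<rat> complex_field" by (rule CF.subringI) auto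
qed auto

text \<open>The factor y is there for the induction: removing the head of Ks replaces y by y *
  x.\<close>

lemma combine_powers:
  "CF.combine Ks (map (\<lambda>i. y * x ^ i) [0..<length Ks]) = y * poly (Poly Ks) x"
proof (induction Ks arbitrary: y)
  case (Cons k Ks)
  have "map (\<lambda>i. y * x ^ i) [0..<length (k # Ks)] = y # map (\<lambda>i. (y * x) * x ^ i) [0..<length Ks]"
    by (simp add: upt_conv_Cons map_Suc_upt[symmetric] mult.assoc del: upt_Suc)
  then show ?case using Cons[of "y * x"] by (simp add: algebra_simps)
qed simp

lemma clear_rational_coeffs:
  assumes "\<And>i. coeff p i \<in> (\<rat> :: complex set)"
  shows "\<exists>d::int. d \<noteq> 0 \<and> (\<forall>i. of_int d * coeff p i \<in> \<int>)"
  using assms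
proof (induction p)
  case 0
  show ?case by (intro exI[of _ 1]) auto
next
  case (pCons a p)
  have "coeff p i \<in> \<rat>" for i using pCons.prems[of "Suc i"] by simp
  with pCons.IH obtain d :: int where d: "d \<noteq> 0" "\<And>i. of_int d * coeff p i \<in> \<int>" by blast
  have "a \<in> \<rat>" using pCons.prems[of 0] by simp
  then obtain m n :: int where mn: "n \<noteq> 0" "a = of_int m / of_int n"
    by (cases a rule: Rats_cases') (metis less_irrefl)
  show ?case
  proof (intro exI[of _ "n * d"] conjI allI)
    fix i
    show "of_int (n * d) * coeff (pCons a p) i \<in> \<int>"
    proof (cases i)
      case 0
      with mn show ?thesis by simp
    next
      case (Suc j)
      have "of_int (n * d) * coeff p j = of_int n * (of_int d * coeff p j)" by simp
      also have "\<dots> \<in> \<int>" by (rule Ints_mult[OF Ints_of_int d(2)])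
      finally show ?thesis by (simp add: Suc)
    qed
  qed (use d mn in auto)
qed

text \<open>The n + 1 powers 1, ..., x^n are linearly dependent in dimension n. The bound is
  \<open>Suc n\<close> because \<open>degree_Poly\<close> compares with the length of the
  coefficient list.\<close>

lemma finite_dimension_degree_bound:
  assumes fd: "ring.finite_dimension complex_field \<rat> E"
    and E: "1 \<in> E" "\<And>x y. x \<in> E \<Longrightarrow> y \<in> E \<Longrightarrow> x * y \<in> E"
  shows "\<exists>D. \<forall>x\<in>E. \<exists>q. q \<noteq> 0 \<and> degree q \<le> D \<and> poly (cpoly q) x = 0"
proof -
  obtain n where n: "CF.dimension n \<rat> E" using fd by (rule CF.finite_dimensionE')
  have "\<exists>q. q \<noteq> 0 \<and> degree q \<le> Suc n \<and> poly (cpoly q) x = 0" if "x \<in> E" for x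
  proof -
    let ?Us = "map (\<lambda>i. 1 * x ^ i) [0..<Suc n]"
    have "x ^ i \<in> E" for i using that E by (induction i) auto
    then have "set ?Us \<subseteq> E" by auto
    then have dep: "\<not> CF.independent \<rat> ?Us"
      using CF.independent_length_le_dimension[OF Rats_subfield n, of ?Us] by (auto simp del: upt_Suc)
    have "set ?Us \<subseteq> carrier complex_field" by (simp del: upt_Suc)
    from CF.dependent_imp_non_trivial_combine[OF Rats_subfield this dep]
    obtain Ks where Ks: "length Ks = length ?Us" "CF.combine Ks ?Us = \<zero>\<^bsub>complex_field\<^esub>"
      "set Ks \<subseteq> \<rat>" "set Ks \<noteq> {\<zero>\<^bsub>complex_field\<^esub>}" by blast
    then have l: "length Ks = Suc n" by simp
    have "CF.combine Ks ?Us = 1 * poly (Poly Ks) x"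
      unfolding l[symmetric] by (rule combine_powers)
    with Ks(2) have root: "poly (Poly Ks) x = 0" by (simp del: upt_Suc)
    have "Poly Ks \<noteq> 0"
    proof
      assume "Poly Ks = 0"
      then obtain k where "Ks = replicate k 0" unfolding Poly_eq_0 by blast
      with l have "k = Suc n" by simp
      with \<open>Ks = replicate k 0\<close> Ks(4) show False by (auto simp: set_replicate_conv_if split: if_splits)
    qed
    have "coeff (Poly Ks) i \<in> \<rat>" for i
      using Ks(3) by (auto simp: coeff_Poly_eq nth_default_def)
    then obtain d :: int where d: "d \<noteq> 0" "\<And>i. of_int d * coeff (Poly Ks) i \<in> \<int>"
      using clear_rational_coeffs by blast
    then have "coeff (Polynomial.smult (of_int d) (Poly Ks)) i \<in> \<int>" for i by simp
    then obtain q where q: "Polynomial.smult (of_int d) (Poly Ks) = cpoly q"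
      by (rule intpolyE)
    have "degree (cpoly q) \<le> length Ks"
      unfolding q[symmetric] by (rule order_trans[OF degree_smult_le]) (rule degree_Poly)
    moreover have "cpoly q \<noteq> 0" unfolding q[symmetric] using d \<open>Poly Ks \<noteq> 0\<close> by simp
    moreover have "poly (cpoly q) x = 0" unfolding q[symmetric] using root by simp
    ultimately show ?thesis using l by auto
  qed
  then show ?thesis by blast
qed

lemma zeta_power_inj: "inj_on (\<lambda>t. zeta m ^ t) {..<m}"
proof (rule inj_onI)
  fix s t assume st: "s \<in> {..<m}" "t \<in> {..<m}" "zeta m ^ s = zeta m ^ t"
  have "zeta m ^ t = exp (2 * of_real pi * \<i> * of_nat t / of_nat m)" for t
    unfolding zeta_def exp_of_nat_mult[symmetric] by (simp add: mult_ac)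
  with st complex_root_unity_eq[of m s t] show "s = t" by simp
qed

lemma zeta_power_m: "m \<noteq> 0 \<Longrightarrow> zeta m ^ m = 1"
  unfolding zeta_def exp_of_nat_mult[symmetric] by simp

lemma finite_C_in:
  assumes fd: "ring.finite_dimension complex_field \<rat> E"
    and E: "1 \<in> E" "\<And>x y. x \<in> E \<Longrightarrow> y \<in> E \<Longrightarrow> x * y \<in> E"
  shows "finite (C_in E)"
proof -
  obtain D where D: "\<And>x. x \<in> E \<Longrightarrow> \<exists>q. q \<noteq> 0 \<and> degree q \<le> D \<and> poly (cpoly q) x = 0"
    using finite_dimension_degree_bound[OF assms] by blast
  \<comment> \<open>The exponent D in place of deg g gives one box for all candidates; this enlarges
    the bound since 4 k + 4 >= 1.\<close>
  define G where "G = {g::int poly. degree g \<le> D \<and> (\<forall>k\<le>D. \<bar>poly g (int k)\<bar> \<le> (4 * int k + 4) ^ D)}"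
  have "finite G" unfolding G_def by (rule finite_int_polys_of_bounded_values)
  have "C_in E \<subseteq> (\<Union>g\<in>G - {0}. {z. poly (cpoly g) z = 0})"
  proof
    fix x assume "x \<in> C_in E"
    then obtain m k1 k2 k3 k4 where m: "m \<ge> 4" and k: "(k1, k2, k3, k4) \<in> D_set m"
      and x: "x = f_quot m (k1, k2, k3, k4)" "x \<in> E"
      by (auto simp: C_in_def C_level_def)
    define P where "P i = 1 - monom (1::int) i" for i
    have P: "poly (cpoly (P i)) z = 1 - z ^ i" for i z by (simp add: P_def poly_monom)
    define N M where "N = P k1 * P k2" and "M = P k3 * P k4"
    have x': "x = poly (cpoly N) (zeta m) / poly (cpoly M) (zeta m)"
      by (simp add: x f_quot_def N_def M_def P)
    have ne1: "zeta m ^ i \<noteq> 1" if "0 < i" "i < m" for i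
    proof
      assume "zeta m ^ i = 1"
      then have "i = 0" using that by (intro inj_onD[OF zeta_power_inj, of m i 0]) simp_all
      with that show False by simp
    qed
    have "1 \<le> k3 \<and> k3 < k1 \<and> k1 \<le> k2 \<and> k2 < k4 \<and> k4 \<le> m - 1" using k by (simp add: D_set_def)
    then have "0 < k3" "k3 < m" "0 < k4" "k4 < m" using m by linarith+
    then have k34: "zeta m ^ k3 \<noteq> 1" "zeta m ^ k4 \<noteq> 1" using ne1 by blast+
    have M: "poly (cpoly M) (zeta m) \<noteq> 0"
      unfolding M_def cpoly_hom poly_mult P using k34 by simp
    \<comment> \<open>Origin of the 4: N and M are products of two factors 1 - z^i, each of norm at
      most 2 on the unit circle.\<close>
    have P2: "norm (poly (cpoly (P i)) z) \<le> 2" if "norm z = 1" for i z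
      unfolding P using norm_triangle_ineq4[of 1 "z ^ i"] that by (simp add: norm_power)
    have NM: "norm (poly (cpoly N) z) \<le> 4" "norm (poly (cpoly M) z) \<le> 4" if "norm z = 1" for z
      using mult_mono[OF P2[OF that] P2[OF that]] by (simp_all add: N_def M_def norm_mult del: mult_eq_0_iff)
    obtain q where q: "q \<noteq> 0" "degree q \<le> D" "poly (cpoly q) x = 0" using D[OF x(2)] by blast
    then obtain g where g: "prime_elem g" "g dvd q" "poly (cpoly g) x = 0"
      using prime_factor_with_root by blast
    have "degree g \<le> D" using dvd_imp_degree_le[OF g(2) q(1)] q(2) by linarith
    have "\<bar>poly g (int k)\<bar> \<le> (4 * int k + 4) ^ D" for k
    proof -
      have "\<bar>poly g (int k)\<bar> \<le> (4 * int k + 4) ^ degree g"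
      proof (rule value_bound_of_quotient_root[where N = N, OF zeta_power_m zeta_power_inj _ M _ g(1)])
        fix z :: complex assume z: "norm z = 1"
        have "norm (poly (cpoly M) z * of_int (int k) - poly (cpoly N) z)
            \<le> norm (poly (cpoly M) z) * real k + norm (poly (cpoly N) z)"
          using norm_triangle_ineq4[of "poly (cpoly M) z * of_int (int k)" "poly (cpoly N) z"]
          by (simp add: norm_mult)
        also have "\<dots> \<le> 4 * real k + 4"
          using NM[OF z] by (intro add_mono mult_right_mono) auto
        finally show "norm (poly (cpoly M) z * of_int (int k) - poly (cpoly N) z) \<le> of_int (4 * int k + 4)"
          by simp
      next
        show "poly (cpoly g) (poly (cpoly N) (zeta m) / poly (cpoly M) (zeta m)) = 0"
          using g(3) unfolding x' .
      qed (use m in simp_all)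
      also have "\<dots> \<le> (4 * int k + 4) ^ D"
        using \<open>degree g \<le> D\<close> by (intro power_increasing) simp_all
      finally show ?thesis .
    qed
    then have "g \<in> G" using \<open>degree g \<le> D\<close> by (simp add: G_def)
    moreover have "g \<noteq> 0" using g(1) by (simp add: prime_elem_def)
    ultimately show "x \<in> (\<Union>g\<in>G - {0}. {z. poly (cpoly g) z = 0})" using g(3) by blast
  qed
  moreover have "finite (\<Union>g\<in>G - {0}. {z. poly (cpoly g) z = 0})"
    using \<open>finite G\<close> by (intro finite_UN_I poly_roots_finite) auto
  ultimately show ?thesis by (rule finite_subset)
qed

section \<open>Bounding the number of directions\<close>

text \<open>The area of real multiples of x and y is a real multiple of (cnj x * y - x * cnj y) /
  (2i). The numerators lie in the field; the scalings and 2i, which need not, cancel in the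
  quotient.\<close>

lemma cross_ratio_in_K_plus:
  assumes dir: "Lambda_direction \<Lambda> u1" "Lambda_direction \<Lambda> u2" "Lambda_direction \<Lambda> u3" "Lambda_direction \<Lambda> u4"
    and np: "Im (cnj u1 * u2) \<noteq> 0" "Im (cnj u1 * u3) \<noteq> 0" "Im (cnj u1 * u4) \<noteq> 0"
      "Im (cnj u2 * u3) \<noteq> 0" "Im (cnj u2 * u4) \<noteq> 0" "Im (cnj u3 * u4) \<noteq> 0"
  shows "complex_of_real (cross_ratio (slope u1) (slope u2) (slope u3) (slope u4)) \<in> K_plus \<Lambda>"
proof -
  have ex: "\<exists>r d. u = of_real r * d \<and> r \<noteq> 0 \<and> d \<in> differences \<Lambda>" if "Lambda_direction \<Lambda> u" for u
    using that by (auto simp: Lambda_direction_def parallel_def)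
  obtain r1 d1 where d1: "u1 = of_real r1 * d1" "r1 \<noteq> 0" "d1 \<in> differences \<Lambda>" using ex[OF dir(1)] by blast
  obtain r2 d2 where d2: "u2 = of_real r2 * d2" "r2 \<noteq> 0" "d2 \<in> differences \<Lambda>" using ex[OF dir(2)] by blast
  obtain r3 d3 where d3: "u3 = of_real r3 * d3" "r3 \<noteq> 0" "d3 \<in> differences \<Lambda>" using ex[OF dir(3)] by blast
  obtain r4 d4 where d4: "u4 = of_real r4 * d4" "r4 \<noteq> 0" "d4 \<in> differences \<Lambda>" using ex[OF dir(4)] by blast
  define w where "w x y = cnj x * y - x * cnj y" for x y :: complex
  have area: "of_real (Im (cnj (of_real r * x) * (of_real s * y))) = of_real r * of_real s * w x y / (2 * \<i>)"
    for r s x y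
    by (simp add: w_def complex_eq_iff Re_divide Im_divide power2_eq_square) (simp add: algebra_simps)
  have K: "x \<in> K_field \<Lambda>" "cnj x \<in> K_field \<Lambda>" if "x \<in> differences \<Lambda>" for x
    using that by (auto simp: K_field_def intro: generate_field.incl)
  have wK: "w x y \<in> K_field \<Lambda>" if "x \<in> differences \<Lambda>" "y \<in> differences \<Lambda>" for x y
    unfolding w_def using that K by (intro K_field_closed) auto
  have "complex_of_real (cross_ratio (slope u1) (slope u2) (slope u3) (slope u4))
      = (of_real (Im (cnj u1 * u3)) * of_real (Im (cnj u2 * u4)))
        / (of_real (Im (cnj u2 * u3)) * of_real (Im (cnj u1 * u4)))"
    by (simp only: cross_ratio_slopes[OF np] of_real_mult of_real_divide)
  also have "\<dots> = (w d1 d3 * w d2 d4) / (w d2 d3 * w d1 d4)"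
    unfolding d1(1) d2(1) d3(1) d4(1) area using d1(2) d2(2) d3(2) d4(2) by simp
  also have "\<dots> \<in> K_field \<Lambda>"
    using wK d1(3) d2(3) d3(3) d4(3) by (intro K_field_closed) auto
  finally show ?thesis by (simp add: K_plus_def)
qed

lemma three_smallest:
  fixes \<theta> :: "'a \<Rightarrow> real"
  assumes "finite U" "card U \<ge> 3" "inj_on \<theta> U"
  shows "\<exists>a\<in>U. \<exists>b\<in>U. \<exists>c\<in>U. \<theta> a < \<theta> b \<and> \<theta> b < \<theta> c \<and> (\<forall>x\<in>U - {a, b, c}. \<theta> c < \<theta> x)"
proof -
  have least: "\<exists>a\<in>W. \<forall>x\<in>W - {a}. \<theta> a < \<theta> x" if "finite W" "W \<noteq> {}" "W \<subseteq> U" for W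
  proof -
    have "Min (\<theta> ` W) \<in> \<theta> ` W" using that by (intro Min_in) auto
    then obtain a where a: "a \<in> W" "\<theta> a = Min (\<theta> ` W)" by force
    have "\<theta> a < \<theta> x" if "x \<in> W - {a}" for x
    proof -
      have "\<theta> a \<le> \<theta> x" unfolding a(2) using that \<open>finite W\<close> by (intro Min_le) auto
      moreover have "\<theta> a \<noteq> \<theta> x"
        using inj_onD[OF assms(3), of a x] that a \<open>W \<subseteq> U\<close> by blast
      ultimately show ?thesis by simp
    qed
    with a show ?thesis by blast
  qed
  have "U \<noteq> {}" using assms by auto
  then obtain a where a: "a \<in> U" "\<And>x. x \<in> U - {a} \<Longrightarrow> \<theta> a < \<theta> x" using least[of U] assms by blast
  have "card (U - {a}) \<ge> 2" using a assms by simp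
  then have "U - {a} \<noteq> {}" by (metis card.empty not_numeral_le_zero)
  then obtain b where b: "b \<in> U - {a}" "\<And>x. x \<in> U - {a} - {b} \<Longrightarrow> \<theta> b < \<theta> x"
    using least[of "U - {a}"] assms by blast
  have "card (U - {a} - {b}) \<ge> 1" using a b assms by simp
  then have "U - {a} - {b} \<noteq> {}" by (metis card.empty not_one_le_zero)
  then obtain c where c: "c \<in> U - {a} - {b}" "\<And>x. x \<in> U - {a} - {b} - {c} \<Longrightarrow> \<theta> c < \<theta> x"
    using least[of "U - {a} - {b}"] assms by blast
  have "\<forall>x\<in>U - {a, b, c}. \<theta> c < \<theta> x" using c(2) by blast
  then show ?thesis using a b c by blast
qed

theorem theorem5p6:
  fixes \<Lambda> :: "complex set"
  assumes "algebraic_Delone_set \<Lambda>"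
  shows "finite (C_in (K_plus \<Lambda>)) \<and>
    (\<exists>b::nat. b > 0 \<and>
      (\<forall>U :: complex set.
        finite U \<and> 4 \<le> card U \<and>
        (\<forall>u\<in>U. Lambda_direction \<Lambda> u) \<and>
        (\<forall>u\<in>U. \<forall>v\<in>U. u \<noteq> v \<longrightarrow> \<not> parallel u v) \<and>
        (\<exists>P. U_polygon U P) \<longrightarrow>
          (\<forall>u1\<in>U. \<forall>u2\<in>U. \<forall>u3\<in>U. \<forall>u4\<in>U.
             line_angle u1 < line_angle u2 \<and> line_angle u2 < line_angle u3 \<and>
             line_angle u3 < line_angle u4 \<longrightarrow>
             complex_of_real (cross_ratio (slope u1) (slope u2) (slope u3) (slope u4))
               \<in> C_in (K_plus \<Lambda>)) \<and>
          card U \<le> b))"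
proof (intro conjI exI allI impI)
  have "ring.finite_dimension complex_field \<rat> (K_field \<Lambda>)"
    using assms by (simp add: algebraic_Delone_set_def)
  then have "finite (C_in (K_field \<Lambda>))"
    using K_field_closed(1,3) by (intro finite_C_in) auto
  then show fin: "finite (C_in (K_plus \<Lambda>))"
    by (rule rev_finite_subset) (auto simp: C_in_def K_plus_def)
  show "3 + card (C_in (K_plus \<Lambda>)) > 0" by simp
  fix U :: "complex set"
  assume "finite U \<and> 4 \<le> card U \<and>
        (\<forall>u\<in>U. Lambda_direction \<Lambda> u) \<and>
        (\<forall>u\<in>U. \<forall>v\<in>U. u \<noteq> v \<longrightarrow> \<not> parallel u v) \<and>
        (\<exists>P. U_polygon U P)"
  then obtain P where U: "finite U" "4 \<le> card U" "\<And>u. u \<in> U \<Longrightarrow> Lambda_direction \<Lambda> u"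
    and np: "\<forall>u\<in>U. \<forall>v\<in>U. u \<noteq> v \<longrightarrow> \<not> parallel u v" and P: "U_polygon U P" by blast
  have u0: "u \<noteq> 0" if "u \<in> U" for u using U(3)[OF that] by (auto simp: Lambda_direction_def)
  have "card U \<ge> 3" using U(2) by simp
  moreover have "0 \<notin> U" using u0 by blast
  ultimately obtain n :: int and \<Delta> :: real and c T where n: "n > 0" and \<Delta>: "\<Delta> \<noteq> 0"
    and T: "\<And>u. u \<in> U \<Longrightarrow> T u \<noteq> 0"
    and rel: "\<And>u v. u \<in> U \<Longrightarrow> v \<in> U \<Longrightarrow>
      T u * T v * Im (cnj u * v) = \<Delta> * sin (pi * of_int (c v - c u) / of_int n)"
    using U_polygon_affinely_regular[OF P U(1) _ _ np] by metis
  let ?cr = "\<lambda>u1 u2 u3 u4. complex_of_real (cross_ratio (slope u1) (slope u2) (slope u3) (slope u4))"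
  have cr: "?cr u1 u2 u3 u4 \<in> C_in (K_plus \<Lambda>)"
    if u: "u1 \<in> U" "u2 \<in> U" "u3 \<in> U" "u4 \<in> U"
      and ord: "line_angle u1 < line_angle u2" "line_angle u2 < line_angle u3" "line_angle u3 < line_angle u4"
    for u1 u2 u3 u4
  proof -
    have nz: "Im (cnj v * w) \<noteq> 0" if "v \<in> U" "w \<in> U" "line_angle v < line_angle w" for v w
    proof -
      have "v \<noteq> w" using that by auto
      then have "\<not> parallel v w" using np that by blast
      then show ?thesis using parallel_iff_Im_eq_0[OF u0 u0] that by blast
    qed
    have "?cr u1 u2 u3 u4 \<in> K_plus \<Lambda>"
      by (rule cross_ratio_in_K_plus; (rule U(3) | rule nz); use u ord in simp)
    moreover have "?cr u1 u2 u3 u4 \<in> (\<Union>m\<in>{4..}. C_level m)"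
    proof -
      define f where "f i = [u1, u2, u3, u4] ! i" for i
      have f: "f 0 = u1" "f 1 = u2" "f 2 = u3" "f 3 = u4" by (simp_all add: f_def numeral_eq_Suc)
      have cases4: "i = 0 \<or> i = 1 \<or> i = 2 \<or> i = 3" if "i < 4" for i :: nat using that by linarith
      have fU: "f i \<in> U" if "i < 4" for i using cases4[OF that] f u by metis
      have fmono: "line_angle (f i) < line_angle (f j)" if "i < j" "j < 4" for i j
      proof -
        have "i = 0 \<and> j = 1 \<or> i = 0 \<and> j = 2 \<or> i = 0 \<and> j = 3 \<or> i = 1 \<and> j = 2 \<or> i = 1 \<and> j = 3 \<or> i = 2 \<and> j = 3"
          using that by linarith
        then show ?thesis by (elim disjE conjE; simp only: f; use ord in linarith)
      qed
      have "\<exists>r. v = of_real r * cis (line_angle v)" if "v \<in> U" for v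
        using line_angle(3)[OF u0[OF that]] .
      then obtain r where r: "\<And>v. v \<in> U \<Longrightarrow> v = of_real (r v) * cis (line_angle v)" by metis
      define S where "S i j = sin (line_angle (f j) - line_angle (f i))" for i j
      define \<rho> where "\<rho> i = T (f i) * r (f i)" for i
      have "complex_of_real (S 0 2 * S 1 3 / (S 1 2 * S 0 3)) \<in> (\<Union>m\<in>{4..}. C_level m)"
      proof (rule cross_ratio_of_sines[OF n \<Delta>])
        show "S i j > 0" if "i < j" "j < 4" for i j
        proof -
          have "i < 4" using that by simp
          then show ?thesis
            unfolding S_def using fmono[OF that] line_angle(1)[OF u0[OF fU[of i]]] line_angle(2)[OF u0[OF fU[OF that(2)]]]
            by (intro sin_gt_zero) linarith+
        qed
        show "\<rho> i * \<rho> j * S i j = \<Delta> * sin (pi * of_int (c (f j) - c (f i)) / of_int n)"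
          if "i < 4" "j < 4" for i j
        proof -
          have "Im (cnj (f i) * f j) = r (f i) * r (f j) * S i j"
            unfolding S_def of_real_cis_area[symmetric] r[OF fU[OF that(1)], symmetric]
              r[OF fU[OF that(2)], symmetric] ..
          with rel[OF fU[OF that(1)] fU[OF that(2)]] show ?thesis by (simp add: \<rho>_def mult_ac)
        qed
        show "\<rho> i \<noteq> 0" if "i < 4" for i
          using T[OF fU[OF that]] r[OF fU[OF that]] u0[OF fU[OF that]] by (auto simp: \<rho>_def)
      qed
      also have "S 0 2 * S 1 3 / (S 1 2 * S 0 3) = cross_ratio (slope u1) (slope u2) (slope u3) (slope u4)"
        unfolding S_def f using u u0 ord by (intro cross_ratio_angles[symmetric]) auto
      finally show ?thesis .
    qed
    ultimately show ?thesis by (simp add: C_in_def)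
  qed
  show "\<forall>u1\<in>U. \<forall>u2\<in>U. \<forall>u3\<in>U. \<forall>u4\<in>U.
      line_angle u1 < line_angle u2 \<and> line_angle u2 < line_angle u3 \<and> line_angle u3 < line_angle u4 \<longrightarrow>
      ?cr u1 u2 u3 u4 \<in> C_in (K_plus \<Lambda>)"
    by (intro ballI impI cr; (elim conjE)?; assumption)
  have inj: "inj_on line_angle U"
  proof (rule inj_onI)
    fix u v assume uv: "u \<in> U" "v \<in> U" "line_angle u = line_angle v"
    obtain r s where rs: "u = of_real r * cis (line_angle u)" "v = of_real s * cis (line_angle v)"
      using line_angle(3)[OF u0[OF uv(1)]] line_angle(3)[OF u0[OF uv(2)]] by blast
    have "Im (cnj u * v) = r * s * sin (line_angle v - line_angle u)"
      unfolding of_real_cis_area[symmetric] rs[symmetric] ..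
    also have "\<dots> = 0" using uv(3) by simp
    finally have "parallel u v" using parallel_iff_Im_eq_0[OF u0[OF uv(1)] u0[OF uv(2)]] by blast
    with np uv(1,2) show "u = v" by blast
  qed
  \<comment> \<open>With the three smallest angles as base, any further direction comes fourth in
    increasing order, as \<open>cr\<close> requires.\<close>
  obtain u1 u2 u3 where u123: "u1 \<in> U" "u2 \<in> U" "u3 \<in> U" "line_angle u1 < line_angle u2"
    "line_angle u2 < line_angle u3" and big: "\<And>x. x \<in> U - {u1, u2, u3} \<Longrightarrow> line_angle u3 < line_angle x"
    using three_smallest[OF U(1) \<open>card U \<ge> 3\<close> inj] by blast
  have "inj_on (?cr u1 u2 u3) (U - {u1, u2, u3})"
  proof (rule inj_onI)
    fix x y assume xy: "x \<in> U - {u1, u2, u3}" "y \<in> U - {u1, u2, u3}" "?cr u1 u2 u3 x = ?cr u1 u2 u3 y"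
    define t1 t2 t3 tx ty where "t1 = line_angle u1" and "t2 = line_angle u2" and "t3 = line_angle u3"
      and "tx = line_angle x" and "ty = line_angle y"
    have bounds: "0 \<le> t1" "t1 < t2" "t2 < t3" "t3 < tx" "t3 < ty" "tx < pi" "ty < pi"
      unfolding t1_def t2_def t3_def tx_def ty_def
      using u123(4,5) big[OF xy(1)] big[OF xy(2)] line_angle(1)[OF u0[OF u123(1)]]
        line_angle(2)[OF u0, of x] line_angle(2)[OF u0, of y] xy(1,2) by blast+
    have pos: "sin (t - s) > 0" if "s < t" "t - s < pi" for s t :: real
      using that by (intro sin_gt_zero) auto
    have p: "sin (t3 - t1) > 0" "sin (t3 - t2) > 0" "sin (tx - t1) > 0" "sin (ty - t1) > 0" "sin (t2 - t1) > 0"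
      by (rule pos; use bounds in linarith)+
    have val: "cross_ratio (slope u1) (slope u2) (slope u3) (slope z) =
      (sin (t3 - t1) * sin (line_angle z - t2)) / (sin (t3 - t2) * sin (line_angle z - t1))"
      if "z \<in> U - {u1, u2, u3}" for z
      unfolding t1_def t2_def t3_def using that u123 u0 big[OF that] by (intro cross_ratio_angles) simp_all
    have "(sin (t3 - t1) * sin (tx - t2)) / (sin (t3 - t2) * sin (tx - t1))
        = (sin (t3 - t1) * sin (ty - t2)) / (sin (t3 - t2) * sin (ty - t1))"
      using xy(3) unfolding of_real_eq_iff val[OF xy(1)] val[OF xy(2)] tx_def ty_def .
    then have "sin (tx - t2) * sin (ty - t1) = sin (ty - t2) * sin (tx - t1)"
      using p by (simp add: frac_eq_eq)
    then have "sin (tx - ty) * sin (t2 - t1) = 0" using sin_cross_identity[of tx t2 ty t1] by simp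
    then have "sin (tx - ty) = 0" using p by simp
    moreover have "- pi < tx - ty" "tx - ty < pi" using bounds by linarith+
    ultimately have "tx - ty = 0" by (metis sin_eq_0_pi)
    then have "line_angle x = line_angle y" by (simp add: tx_def ty_def)
    then show "x = y" by (rule inj_onD[OF inj]) (use xy in blast)+
  qed
  moreover have "?cr u1 u2 u3 ` (U - {u1, u2, u3}) \<subseteq> C_in (K_plus \<Lambda>)"
  proof (intro image_subsetI)
    fix x assume "x \<in> U - {u1, u2, u3}"
    then show "?cr u1 u2 u3 x \<in> C_in (K_plus \<Lambda>)" using big u123 by (intro cr) simp_all
  qed
  ultimately have "card (U - {u1, u2, u3}) \<le> card (C_in (K_plus \<Lambda>))"
    using fin by (intro card_inj_on_le)
  moreover have "card U - card {u1, u2, u3} \<le> card (U - {u1, u2, u3})"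
    by (rule diff_card_le_card_Diff) simp
  moreover have "card {u1, u2, u3} \<le> 3" by (simp add: card_insert_if)
  ultimately show "card U \<le> 3 + card (C_in (K_plus \<Lambda>))" by linarith
qed

end
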